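(* (Case (r17).) Let $H(x,y)=\frac{y^2}{2}+\frac{(2x+3)x^2}{6}$ and, for $h\in(0,1/6)$, let $\gamma_h$ be the oval surrounding the origin inside the level curve $\{H(x,y)=h\}$, in the period annulus of the origin whose projection on the $x$-axis is $(-1,1/2)$. For $i=0,1,2$ define $$\widetilde I_i(h)=\int_{\gamma_h}(x+1)^{i-3}\,y\,dx .$$ Then $\{\widetilde I_0,\widetilde I_1,\widetilde I_2\}$ is an ECT-system on $(0,1/6)$.
   Context: The origin is a local minimum of $H$, and the period annulus is the punctured neighbourhood of the origin foliated by the closed curves (ovals) $\gamma_h\subset\{H=h\}$ surrounding the origin. An ordered tuple $(f_0,\ldots,f_{n-1})$ of analytic functions on an open interval $L$ is an extended complete Chebyshev system (ECT-system) on $L$ if, for all $k=1,\ldots,n$, any nontrivial linear combination $\alpha_0f_0+\cdots+\alpha_{k-1}f_{k-1}$ (which is understood not to vanish identically) has at most $k-1$ isolated zeros on $L$ counted with multiplicities; equivalently, the Wronskian $\det(f_j^{(i)}(x))_{0\le i,j\le k-1}\neq0$ for all $k=1,\ldots,n$ and all $x\in L$. A set $\{f_0,\ldots,f_{n-1}\}$ is called an ECT-system on $L$ if its elements form an ECT-system on $L$ when taken in some order. *)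

theory Defs
  imports "HOL-Complex_Analysis.Complex_Analysis"
begin

definition real_analytic_on :: "(real \<Rightarrow> real) \<Rightarrow> real set \<Rightarrow> bool" where
  "real_analytic_on f L \<longleftrightarrow>
     (\<forall>x\<in>L. \<exists>r>0. \<exists>a :: nat \<Rightarrow> real. \<forall>y. \<bar>y - x\<bar> < r \<longrightarrow> (\<lambda>n. a n * (y - x) ^ n) sums f y)"

(* Only meaningful if some derivative of f does not vanish at x; this is guaranteed below,
   where f is analytic and not identically zero on an open interval containing x. *)
definition zero_multiplicity :: "(real \<Rightarrow> real) \<Rightarrow> real \<Rightarrow> nat" where
  "zero_multiplicity f x = (LEAST n. (deriv ^^ n) f x \<noteq> 0)"

(* All zeros of an analytic function that is not identically zero on an interval are isolated,
   so isolatedness is not a separate condition on the zeros counted in ECT_system. *)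
definition at_most_zeros_on :: "nat \<Rightarrow> (real \<Rightarrow> real) \<Rightarrow> real set \<Rightarrow> bool" where
  "at_most_zeros_on m f L \<longleftrightarrow>
     finite {x\<in>L. f x = 0} \<and> (\<Sum>x\<in>{x\<in>L. f x = 0}. zero_multiplicity f x) \<le> m"

(* The ordered tuple (f 0, ..., f (n - 1)). *)
definition ECT_system :: "(nat \<Rightarrow> real \<Rightarrow> real) \<Rightarrow> nat \<Rightarrow> real set \<Rightarrow> bool" where
  "ECT_system f n L \<longleftrightarrow>
     open L \<and> is_interval L \<and> (\<forall>j<n. real_analytic_on (f j) L) \<and>
     (\<forall>k\<in>{1..n}. \<forall>\<alpha> :: nat \<Rightarrow> real. (\<exists>j<k. \<alpha> j \<noteq> 0) \<longrightarrow>
        (\<exists>x\<in>L. (\<Sum>j<k. \<alpha> j * f j x) \<noteq> 0) \<and>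
        at_most_zeros_on (k - 1) (\<lambda>x. \<Sum>j<k. \<alpha> j * f j x) L)"

(* The set {f 0, ..., f (n - 1)}: an ECT-system in some order. *)
definition ECT_system_set :: "(nat \<Rightarrow> real \<Rightarrow> real) \<Rightarrow> nat \<Rightarrow> real set \<Rightarrow> bool" where
  "ECT_system_set f n L \<longleftrightarrow> (\<exists>p. bij_betw p {..<n} {..<n} \<and> ECT_system (\<lambda>j. f (p j)) n L)"

definition H :: "real \<Rightarrow> real \<Rightarrow> real" where
  "H x y = y^2 / 2 + (2 * x + 3) * x^2 / 6"

(* Planar curves are paths in the complex plane, (x, y) being x + i y.
   The path g parametrizes the oval of the level h surrounding the origin
   (valid_path: piecewise continuously differentiable). The level set also has an unbounded
   branch, on which x < -1; the strip bounds are those of the period annulus. *)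
definition oval_parametrization :: "real \<Rightarrow> (real \<Rightarrow> complex) \<Rightarrow> bool" where
  "oval_parametrization h g \<longleftrightarrow>
     valid_path g \<and> simple_path g \<and> pathfinish g = pathstart g \<and>
     path_image g \<subseteq> {z. H (Re z) (Im z) = h \<and> -1 < Re z \<and> Re z < 1/2} \<and>
     0 \<in> inside (path_image g)"

(* The line integral of the differential form F(x,y) dx along g. *)
definition line_integral_dx :: "(real \<Rightarrow> real \<Rightarrow> real) \<Rightarrow> (real \<Rightarrow> complex) \<Rightarrow> real" where
  "line_integral_dx F g =
     integral {0..1} (\<lambda>t. F (Re (g t)) (Im (g t)) * Re (vector_derivative g (at t within {0..1})))"

(* The integrals over the ovals g h of the form (x+1)^(i-3) y dx. *)
definition I_tilde :: "(real \<Rightarrow> real \<Rightarrow> complex) \<Rightarrow> nat \<Rightarrow> real \<Rightarrow> real" where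
  "I_tilde g i h = line_integral_dx (\<lambda>x y. (x + 1) powi (int i - 3) * y) (g h)"

end

theory Submission
  imports Defs
begin

text \<open>
  Put \<open>u = x + 1\<close>. On the oval of level \<open>h\<close> one has \<open>W\<^sup>2 + 3 y\<^sup>2 = 6 h\<close> with
  \<open>W\<^sup>2 = 2 u ^ 3 - 3 u\<^sup>2 + 1\<close>, and the substitution \<open>u = 1/2 + cos \<alpha>\<close> gives \<open>W = cos (3 \<alpha> / 2)\<close>.
  In the coordinates \<open>(W, sqrt 3 y)\<close> the ovals are therefore concentric circles, and the line integral of
  \<open>u ^ k y dx\<close> equals, up to the common factor given by the orientation, an explicit integral \<open>J k h\<close>
  over the angle. The angular form makes \<open>J k\<close> analytic in \<open>h\<close> and yields two families of
  linear relations between the integrals and their derivatives.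

  Write \<open>X, Y, Z\<close> for \<open>J (-3), J (-2), J (-1)\<close>, let \<open>K\<close> be the derivative of \<open>J 1\<close>, and let
  \<open>t = 1 - 6 h\<close>. The relations reduce to the system
  \<open>t X' = 3 X + Y + K\<close>, \<open>t Y' = K\<close>, \<open>t Z' = K - 3 Z\<close>, \<open>6 h K' = - Y\<close>.
  All three integrals vanish at the centre \<open>h = 0\<close>, so for \<open>F = a X + b Y + c Z\<close> Rolle's theorem loses no
  zero when \<open>F / sqrt t\<close> is differentiated. This produces a function \<open>P\<close> without \<open>Z\<close>;
  differentiating \<open>sqrt t P\<close> at the cost of one zero then eliminates \<open>X\<close>. What remains is
  \<open>Y / sqrt t\<close> times an affine combination of \<open>1\<close>, \<open>m = t / (6 h)\<close> and \<open>D = K / Y - 6 m\<close>.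

  The decisive fact is that \<open>D\<close>, as a function of \<open>m\<close>, is strictly increasing and strictly concave, which follows
  from its Riccati equation and the bounds \<open>0 < D < 35/12\<close>. Such a combination has at most
  one zero, which gives at most two zeros of \<open>F\<close>, unless the coefficients of \<open>m\<close> and \<open>D\<close> have opposite signs.
  In that case it either has constant sign, or \<open>a\<close> has the sign for which the behaviour of \<open>P\<close>
  at the saddle loop \<open>h = 1/6\<close>, where \<open>X\<close> dominates, removes the excess zero. Two-term combinations of \<open>Y\<close> and \<open>Z\<close>
  need only the monotonicity of \<open>K / Y\<close>, and \<open>Y\<close> is positive, so \<open>(Y, Z, X)\<close> is an ordered ECT-system.
\<close>

section \<open>Real-analytic functions\<close>

text \<open>Real analyticity is handled through holomorphic extensions, so that the Leibniz rule for higher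
  derivatives, power series expansions and the identity theorem are inherited from complex analysis.\<close>
definition analytic_at_real :: "(real \<Rightarrow> real) \<Rightarrow> real \<Rightarrow> bool" where
  "analytic_at_real f x \<longleftrightarrow>
     (\<exists>F. F analytic_on {complex_of_real x} \<and>
          eventually (\<lambda>y. F (complex_of_real y) = complex_of_real (f y)) (nhds x))"

lemma eventually_analytic_of_real:
  assumes "F analytic_on {complex_of_real x}"
  shows "eventually (\<lambda>y. F analytic_on {complex_of_real y}) (nhds x)"
proof -
  obtain e where e: "e > 0" "F holomorphic_on ball (complex_of_real x) e"
    using assms by (auto simp: analytic_at_ball)
  have "F analytic_on {complex_of_real y}" if "dist y x < e" for y
  proof -
    have "complex_of_real y \<in> ball (complex_of_real x) e"
      using that by (simp add: dist_of_real dist_commute)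
    then show ?thesis
      using e holomorphic_on_imp_analytic_at by blast
  qed
  then show ?thesis
    using e eventually_nhds_metric by blast
qed

lemma extension_derivative:
  assumes F: "F analytic_on {complex_of_real x}"
    and eq: "eventually (\<lambda>y. F (complex_of_real y) = complex_of_real (f y)) (nhds x)"
  shows "(f has_real_derivative Re (deriv F (complex_of_real x))) (at x)"
    and "deriv F (complex_of_real x) = complex_of_real (deriv f x)"
proof -
  have dF: "(F has_field_derivative deriv F (complex_of_real x)) (at (complex_of_real x))"
    using F analytic_on_imp_differentiable_at DERIV_deriv_iff_field_differentiable by blast
  have v: "((\<lambda>y. F (complex_of_real y)) has_vector_derivative deriv F (complex_of_real x)) (at x)"
    using has_vector_derivative_real_field[of F "deriv F (complex_of_real x)" x UNIV] dF
    by (simp add: has_field_derivative_at_within)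
  have c: "((\<lambda>y. complex_of_real (f y)) has_vector_derivative deriv F (complex_of_real x)) (at x)"
    by (rule has_vector_derivative_cong_ev[THEN iffD1, OF _ _ v])
       (use eq eventually_nhds_x_imp_x[OF eq] in \<open>auto elim: eventually_mono\<close>)
  show 1: "(f has_real_derivative Re (deriv F (complex_of_real x))) (at x)"
    using bounded_linear.has_vector_derivative[OF bounded_linear_Re c]
    by (simp add: has_real_derivative_iff_has_vector_derivative)
  have "Im (deriv F (complex_of_real x)) = 0"
    using bounded_linear.has_vector_derivative[OF bounded_linear_Im c]
      vector_derivative_unique_at[of "\<lambda>y. 0::real"] by force
  then show "deriv F (complex_of_real x) = complex_of_real (deriv f x)"
    using 1 by (simp add: DERIV_imp_deriv complex_eq_iff)
qed

lemma extension_deriv_eventually: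
  assumes F: "F analytic_on {complex_of_real x}"
    and eq: "eventually (\<lambda>y. F (complex_of_real y) = complex_of_real (f y)) (nhds x)"
  shows "eventually (\<lambda>y. deriv F (complex_of_real y) = complex_of_real (deriv f y)) (nhds x)"
  using eventually_analytic_of_real[OF F] eventually_eventually[THEN iffD2, OF eq]
  by eventually_elim (rule extension_derivative(2))

lemma extension_higher_deriv_eventually:
  assumes F: "F analytic_on {complex_of_real x}"
    and eq: "eventually (\<lambda>y. F (complex_of_real y) = complex_of_real (f y)) (nhds x)"
  shows "eventually (\<lambda>y. (deriv ^^ n) F (complex_of_real y) = complex_of_real ((deriv ^^ n) f y)) (nhds x)"
proof (induction n)
  case 0
  then show ?case using eq by simp
next
  case (Suc n)
  have "(deriv ^^ n) F analytic_on {complex_of_real x}"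
    using F by (rule analytic_higher_deriv)
  from extension_deriv_eventually[OF this Suc] show ?case
    by (simp only: funpow.simps o_apply)
qed

lemma extension_higher_deriv:
  assumes F: "F analytic_on {complex_of_real x}"
    and eq: "eventually (\<lambda>y. F (complex_of_real y) = complex_of_real (f y)) (nhds x)"
  shows "(deriv ^^ n) F (complex_of_real x) = complex_of_real ((deriv ^^ n) f x)"
  using eventually_nhds_x_imp_x[OF extension_higher_deriv_eventually[OF assms]] .

lemma analytic_at_real_deriv:
  assumes "analytic_at_real f x"
  shows "analytic_at_real (deriv f) x"
  using assms extension_deriv_eventually analytic_deriv unfolding analytic_at_real_def by metis

lemma analytic_at_real_has_derivative:
  assumes "analytic_at_real f x"
  shows "(f has_real_derivative deriv f x) (at x)"
  using assms extension_derivative DERIV_imp_deriv unfolding analytic_at_real_def by metis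

lemma analytic_at_real_cong:
  assumes "eventually (\<lambda>y. f y = g y) (nhds x)" and "analytic_at_real f x"
  shows "analytic_at_real g x"
proof -
  obtain F where "F analytic_on {complex_of_real x}"
      and "eventually (\<lambda>y. F (complex_of_real y) = complex_of_real (f y)) (nhds x)"
    using assms(2) unfolding analytic_at_real_def by blast
  moreover from this(2) assms(1)
  have "eventually (\<lambda>y. F (complex_of_real y) = complex_of_real (g y)) (nhds x)"
    by eventually_elim simp
  ultimately show ?thesis unfolding analytic_at_real_def by blast
qed

lemma analytic_at_real_cong_open:
  assumes "open L" "x \<in> L" "\<And>y. y \<in> L \<Longrightarrow> f y = g y" and "analytic_at_real f x"
  shows "analytic_at_real g x"
  using assms eventually_nhds by (intro analytic_at_real_cong[OF _ assms(4)]) blast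

lemma analytic_at_real_const: "analytic_at_real (\<lambda>y. c) x"
  unfolding analytic_at_real_def by (rule exI[of _ "\<lambda>_. complex_of_real c"]) auto

lemma analytic_at_real_ident: "analytic_at_real (\<lambda>y. y) x"
  unfolding analytic_at_real_def by (rule exI[of _ "\<lambda>z. z"]) auto

lemma analytic_at_real_add:
  assumes "analytic_at_real f x" "analytic_at_real g x"
  shows "analytic_at_real (\<lambda>y. f y + g y) x"
proof -
  obtain F G where FG: "F analytic_on {complex_of_real x}" "G analytic_on {complex_of_real x}"
      and "eventually (\<lambda>y. F (complex_of_real y) = complex_of_real (f y)) (nhds x)"
          "eventually (\<lambda>y. G (complex_of_real y) = complex_of_real (g y)) (nhds x)"
    using assms unfolding analytic_at_real_def by blast
  from this(3,4) have "eventually (\<lambda>y. F (complex_of_real y) + G (complex_of_real y)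
      = complex_of_real (f y + g y)) (nhds x)"
    by eventually_elim simp
  with analytic_on_add[OF FG] show ?thesis unfolding analytic_at_real_def by fast
qed

lemma analytic_at_real_mult:
  assumes "analytic_at_real f x" "analytic_at_real g x"
  shows "analytic_at_real (\<lambda>y. f y * g y) x"
proof -
  obtain F G where FG: "F analytic_on {complex_of_real x}" "G analytic_on {complex_of_real x}"
      and "eventually (\<lambda>y. F (complex_of_real y) = complex_of_real (f y)) (nhds x)"
          "eventually (\<lambda>y. G (complex_of_real y) = complex_of_real (g y)) (nhds x)"
    using assms unfolding analytic_at_real_def by blast
  from this(3,4) have "eventually (\<lambda>y. F (complex_of_real y) * G (complex_of_real y)
      = complex_of_real (f y * g y)) (nhds x)"
    by eventually_elim simp
  with analytic_on_mult[OF FG] show ?thesis unfolding analytic_at_real_def by fast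
qed

lemma analytic_at_real_divide:
  assumes "analytic_at_real f x" "analytic_at_real g x" "g x \<noteq> 0"
  shows "analytic_at_real (\<lambda>y. f y / g y) x"
proof -
  obtain F G where FG: "F analytic_on {complex_of_real x}" "G analytic_on {complex_of_real x}"
      and e: "eventually (\<lambda>y. F (complex_of_real y) = complex_of_real (f y)) (nhds x)"
          "eventually (\<lambda>y. G (complex_of_real y) = complex_of_real (g y)) (nhds x)"
    using assms unfolding analytic_at_real_def by blast
  have "G (complex_of_real x) \<noteq> 0"
    using eventually_nhds_x_imp_x[OF e(2)] assms(3) by simp
  then have "(\<lambda>z. F z / G z) analytic_on {complex_of_real x}"
    using FG by (intro analytic_on_divide) auto
  moreover from e have "eventually (\<lambda>y. F (complex_of_real y) / G (complex_of_real y)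
      = complex_of_real (f y / g y)) (nhds x)"
    by eventually_elim simp
  ultimately show ?thesis unfolding analytic_at_real_def by fast
qed

lemma analytic_at_real_diff:
  assumes "analytic_at_real f x" "analytic_at_real g x"
  shows "analytic_at_real (\<lambda>y. f y - g y) x"
  using analytic_at_real_add[OF assms(1) analytic_at_real_mult[OF analytic_at_real_const[of "-1"] assms(2)]]
  by simp

lemma analytic_at_real_compose:
  assumes "analytic_at_real f (g x)" "analytic_at_real g x"
  shows "analytic_at_real (\<lambda>y. f (g y)) x"
proof -
  obtain F G where F: "F analytic_on {complex_of_real (g x)}" and G: "G analytic_on {complex_of_real x}"
      and eF: "eventually (\<lambda>y. F (complex_of_real y) = complex_of_real (f y)) (nhds (g x))"
      and eG: "eventually (\<lambda>y. G (complex_of_real y) = complex_of_real (g y)) (nhds x)"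
    using assms unfolding analytic_at_real_def by blast
  have Gx: "G (complex_of_real x) = complex_of_real (g x)"
    by (rule eventually_nhds_x_imp_x[OF eG])
  have "(F \<circ> G) analytic_on {complex_of_real x}"
    using F G Gx by (intro analytic_on_compose) auto
  moreover have "filterlim g (nhds (g x)) (nhds x)"
    using analytic_at_real_has_derivative[OF assms(2)] DERIV_isCont isCont_def tendsto_at_iff_tendsto_nhds by metis
  then have "eventually (\<lambda>y. F (complex_of_real (g y)) = complex_of_real (f (g y))) (nhds x)"
    using eF unfolding filterlim_iff by blast
  then have "eventually (\<lambda>y. (F \<circ> G) (complex_of_real y) = complex_of_real (f (g y))) (nhds x)"
    using eG by eventually_elim simp
  ultimately show ?thesis unfolding analytic_at_real_def by blast
qed

lemma analytic_at_real_sqrt_affine: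
  assumes "a + b * x > 0"
  shows "analytic_at_real (\<lambda>y. sqrt (a + b * y)) x"
proof -
  define G where "G = (\<lambda>z. csqrt (complex_of_real a + complex_of_real b * z))"
  have "complex_of_real a + complex_of_real b * complex_of_real x = complex_of_real (a + b * x)"
    by simp
  then have "G analytic_on {complex_of_real x}" unfolding G_def
    using assms by (intro analytic_on_csqrt' analytic_intros) (auto simp del: of_real_add of_real_mult simp: complex_nonpos_Reals_iff)
  moreover have "eventually (\<lambda>y. a + b * y > 0) (nhds x)"
  proof -
    have "continuous_on UNIV (\<lambda>y. a + b * y)" by (intro continuous_intros)
    then have "open {y. a + b * y > 0}" by (intro open_Collect_less continuous_intros)
    then show ?thesis using assms eventually_nhds by fast
  qed
  then have "eventually (\<lambda>y. G (complex_of_real y) = complex_of_real (sqrt (a + b * y))) (nhds x)"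
    by eventually_elim (simp only: G_def of_real_mult[symmetric] of_real_add[symmetric] of_real_sqrt less_imp_le)
  ultimately show ?thesis unfolding analytic_at_real_def by blast
qed

lemmas analytic_at_real_intros =
  analytic_at_real_const analytic_at_real_ident analytic_at_real_add analytic_at_real_diff
  analytic_at_real_mult analytic_at_real_divide

lemma real_analytic_on_if_analytic_at_real:
  assumes "\<And>x. x \<in> L \<Longrightarrow> analytic_at_real f x"
  shows "real_analytic_on f L"
  unfolding real_analytic_on_def
proof
  fix x assume "x \<in> L"
  then obtain F where F: "F analytic_on {complex_of_real x}"
      and eq: "eventually (\<lambda>y. F (complex_of_real y) = complex_of_real (f y)) (nhds x)"
    using assms unfolding analytic_at_real_def by blast
  obtain e where e: "e > 0" "F holomorphic_on ball (complex_of_real x) e"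
    using F by (auto simp: analytic_at_ball)
  obtain d where d: "d > 0" "\<And>y. dist y x < d \<Longrightarrow> F (complex_of_real y) = complex_of_real (f y)"
    using eq unfolding eventually_nhds_metric by blast
  have "(\<lambda>n. (deriv ^^ n) f x / fact n * (y - x) ^ n) sums f y" if y: "\<bar>y - x\<bar> < min d e" for y
  proof -
    have "complex_of_real y \<in> ball (complex_of_real x) e"
      using y by (simp add: dist_of_real dist_real_def abs_minus_commute)
    from holomorphic_power_series[OF e(2) this]
    have "(\<lambda>n. complex_of_real ((deriv ^^ n) f x / fact n * (y - x) ^ n)) sums complex_of_real (f y)"
      using d(2)[of y] y by (simp add: extension_higher_deriv[OF F eq] dist_real_def)
    then show ?thesis by (simp only: sums_of_real_iff)
  qed
  then show "\<exists>r>0. \<exists>a. \<forall>y. \<bar>y - x\<bar> < r \<longrightarrow> (\<lambda>n. a n * (y - x) ^ n) sums f y"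
    using d(1) e(1) by (intro exI[of _ "min d e"] conjI exI[of _ "\<lambda>n. (deriv ^^ n) f x / fact n"]) auto
qed

section \<open>Zeros counted with multiplicity\<close>

lemma Least_eqI_initial_segments:
  fixes P Q :: "nat \<Rightarrow> bool"
  assumes "\<And>n. (\<forall>i<n. \<not> P i) \<longleftrightarrow> (\<forall>i<n. \<not> Q i)"
  shows "(LEAST n. P n) = (LEAST n. Q n)"
proof -
  have "P n \<longleftrightarrow> Q n" if "\<forall>i<n. \<not> P i" for n
    using assms[of n] assms[of "Suc n"] that less_Suc_eq by metis
  then have *: "(P n \<and> (\<forall>i<n. \<not> P i)) \<longleftrightarrow> (Q n \<and> (\<forall>i<n. \<not> Q i))" for n
    using assms[of n] by blast
  have L: "(LEAST n. R n) = (THE n. R n \<and> (\<forall>i<n. \<not> R i))" for R :: "nat \<Rightarrow> bool"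
    unfolding Least_def by (rule arg_cong[where f=The]) (meson linorder_not_less)
  show ?thesis unfolding L * ..
qed

text \<open>Vanishing to order \<open>n\<close> is stable under products, by the Leibniz rule for the extensions.\<close>
lemma higher_derivs_vanish_mult:
  assumes f: "analytic_at_real f x" and g: "analytic_at_real g x"
    and "\<forall>i<n. (deriv ^^ i) f x = 0"
  shows "\<forall>i<n. (deriv ^^ i) (\<lambda>y. f y * g y) x = 0"
proof (intro allI impI)
  fix i assume "i < n"
  obtain F G where FG: "F analytic_on {complex_of_real x}" "G analytic_on {complex_of_real x}"
      and e: "eventually (\<lambda>y. F (complex_of_real y) = complex_of_real (f y)) (nhds x)"
          "eventually (\<lambda>y. G (complex_of_real y) = complex_of_real (g y)) (nhds x)"
    using f g unfolding analytic_at_real_def by blast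
  from e have e2: "eventually (\<lambda>y. F (complex_of_real y) * G (complex_of_real y)
      = complex_of_real (f y * g y)) (nhds x)"
    by eventually_elim simp
  have "complex_of_real ((deriv ^^ i) (\<lambda>y. f y * g y) x) = 0"
    unfolding extension_higher_deriv[OF analytic_on_mult[OF FG] e2, symmetric] higher_deriv_mult_at[OF FG]
    using assms(3) \<open>i < n\<close> by (intro sum.neutral) (auto simp: extension_higher_deriv[OF FG(1) e(1)])
  then show "(deriv ^^ i) (\<lambda>y. f y * g y) x = 0" by simp
qed

lemma higher_deriv_real_cong_ev:
  fixes f g :: "real \<Rightarrow> real"
  assumes "eventually (\<lambda>y. f y = g y) (nhds x)"
  shows "(deriv ^^ n) f x = (deriv ^^ n) g x"
proof -
  have "eventually (\<lambda>y. (deriv ^^ n) f y = (deriv ^^ n) g y) (nhds x)"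
  proof (induction n)
    case 0
    then show ?case using assms by simp
  next
    case (Suc n)
    from eventually_eventually[THEN iffD2, OF Suc] show ?case
      by eventually_elim (auto intro: deriv_cong_ev)
  qed
  then show ?thesis by (rule eventually_nhds_x_imp_x)
qed

lemma zero_multiplicity_cong:
  assumes "eventually (\<lambda>y. f y = g y) (nhds x)"
  shows "zero_multiplicity f x = zero_multiplicity g x"
  unfolding zero_multiplicity_def higher_deriv_real_cong_ev[OF assms] ..

text \<open>Multiplication by an analytic factor cannot lower the order of vanishing; the factors \<open>g\<close> and \<open>1 / g\<close>
  undo each other.\<close>
lemma zero_multiplicity_mult:
  assumes f: "analytic_at_real f x" and g: "analytic_at_real g x" and "g x \<noteq> 0"
  shows "zero_multiplicity (\<lambda>y. f y * g y) x = zero_multiplicity f x"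
proof -
  have "(g \<longlongrightarrow> g x) (nhds x)"
    using g analytic_at_real_has_derivative DERIV_isCont isCont_def tendsto_at_iff_tendsto_nhds by metis
  then have "eventually (\<lambda>y. g y \<noteq> 0) (nhds x)"
    using \<open>g x \<noteq> 0\<close> by (rule tendsto_imp_eventually_ne)
  then have ev: "eventually (\<lambda>y. (f y * g y) * (1 / g y) = f y) (nhds x)"
    by eventually_elim simp
  have "(\<forall>i<n. (deriv ^^ i) (\<lambda>y. f y * g y) x = 0) \<longleftrightarrow> (\<forall>i<n. (deriv ^^ i) f x = 0)" for n
  proof
    assume "\<forall>i<n. (deriv ^^ i) (\<lambda>y. f y * g y) x = 0"
    then have "\<forall>i<n. (deriv ^^ i) (\<lambda>y. (f y * g y) * (1 / g y)) x = 0"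
      by (rule higher_derivs_vanish_mult
          [OF analytic_at_real_mult[OF f g] analytic_at_real_divide[OF analytic_at_real_const g \<open>g x \<noteq> 0\<close>]])
    then show "\<forall>i<n. (deriv ^^ i) f x = 0"
      unfolding higher_deriv_real_cong_ev[OF ev] .
  qed (use higher_derivs_vanish_mult[OF f g] in blast)
  then show ?thesis
    unfolding zero_multiplicity_def by (intro Least_eqI_initial_segments) auto
qed

lemma at_most_zeros_on_mult:
  assumes "open L"
    and "\<And>x. x \<in> L \<Longrightarrow> analytic_at_real f x" "\<And>x. x \<in> L \<Longrightarrow> analytic_at_real g x"
    and "\<And>x. x \<in> L \<Longrightarrow> g x \<noteq> 0"
    and u: "\<And>x. x \<in> L \<Longrightarrow> u x = f x * g x"
  shows "at_most_zeros_on n u L \<longleftrightarrow> at_most_zeros_on n f L"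
proof -
  have "zero_multiplicity u x = zero_multiplicity f x" if "x \<in> L" for x
  proof -
    have "eventually (\<lambda>y. u y = f y * g y) (nhds x)"
      using \<open>open L\<close> that u eventually_nhds by blast
    then show ?thesis
      using zero_multiplicity_cong zero_multiplicity_mult assms that by metis
  qed
  moreover have "{x \<in> L. u x = 0} = {x \<in> L. f x = 0}"
    using assms by auto
  moreover have "(\<Sum>x\<in>{x \<in> L. f x = 0}. zero_multiplicity u x) = (\<Sum>x\<in>{x \<in> L. f x = 0}. zero_multiplicity f x)"
    using calculation(1) by (intro sum.cong) auto
  ultimately show ?thesis
    unfolding at_most_zeros_on_def by simp
qed

text \<open>A zero at which every derivative vanishes would have neighbouring zeros by the identity theorem, so finiteness
  of the zero set excludes it. Without this, the multiplicity could be an unspecified natural number.\<close>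
lemma zero_multiplicity_pos:
  assumes "analytic_at_real f x" "finite {y \<in> L. f y = 0}" "open L" "x \<in> L" "f x = 0"
  shows "zero_multiplicity f x \<ge> 1"
proof (rule ccontr)
  assume "\<not> zero_multiplicity f x \<ge> 1"
  then have 0: "zero_multiplicity f x = 0" by simp
  obtain F where F: "F analytic_on {complex_of_real x}"
      and eq: "eventually (\<lambda>y. F (complex_of_real y) = complex_of_real (f y)) (nhds x)"
    using assms(1) unfolding analytic_at_real_def by blast
  have flat: "(deriv ^^ n) f x = 0" for n
  proof (rule ccontr)
    assume "(deriv ^^ n) f x \<noteq> 0"
    then have "(deriv ^^ (zero_multiplicity f x)) f x \<noteq> 0"
      unfolding zero_multiplicity_def by (rule LeastI)
    then show False using 0 assms(5) by simp
  qed
  obtain e where e: "e > 0" "F holomorphic_on ball (complex_of_real x) e"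
    using F by (auto simp: analytic_at_ball)
  have "F (complex_of_real y) = 0" if "dist y x < e" for y
    by (rule holomorphic_fun_eq_0_on_ball[OF e(2)])
       (use that in \<open>auto simp: dist_of_real dist_commute extension_higher_deriv[OF F eq] flat\<close>)
  then have "eventually (\<lambda>y. F (complex_of_real y) = 0) (nhds x)"
    using e(1) eventually_nhds_metric by blast
  with eq have "eventually (\<lambda>y. f y = 0) (nhds x)"
    by eventually_elim simp
  moreover have "eventually (\<lambda>y. y \<in> L) (nhds x)"
    using assms eventually_nhds by blast
  ultimately have "eventually (\<lambda>y. y \<in> {y \<in> L. f y = 0}) (nhds x)"
    by eventually_elim simp
  then obtain S where "open S" "x \<in> S" "S \<subseteq> {y \<in> L. f y = 0}"
    unfolding eventually_nhds by blast
  then show False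
    using assms(2) finite_subset finite_imp_not_open[of S] by blast
qed

text \<open>At a flat zero the two least-number expressions range over the same
  empty set of candidates, so the inequality persists there.\<close>
lemma zero_multiplicity_le_Suc_deriv:
  assumes "f x = 0"
  shows "zero_multiplicity f x \<le> Suc (zero_multiplicity (deriv f) x)"
proof -
  have shift: "(deriv ^^ n) (deriv f) x = (deriv ^^ Suc n) f x" for n
    by (simp only: funpow_Suc_right o_def)
  show ?thesis
  proof (cases "\<exists>n. (deriv ^^ n) (deriv f) x \<noteq> 0")
    case True
    then have "(deriv ^^ (zero_multiplicity (deriv f) x)) (deriv f) x \<noteq> 0"
      unfolding zero_multiplicity_def by (rule LeastI_ex)
    then show ?thesis
      unfolding shift zero_multiplicity_def[of f] by (rule Least_le)
  next
    case False
    then have "(deriv ^^ n) f x = 0" for n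
      using assms shift by (cases n) auto
    then show ?thesis
      using False by (simp add: zero_multiplicity_def)
  qed
qed

text \<open>Only right-continuity is required at the left end \<open>l\<close>, so that \<open>l\<close> itself
  may belong to \<open>S\<close>. The last clause locates the new points to the left of the largest zero, which keeps
  the point found in the next step of the induction distinct from the earlier ones.\<close>
lemma rolle_points:
  fixes f u :: "real \<Rightarrow> real"
  assumes "finite S" "S \<subseteq> {l..<r}" "\<And>x. x \<in> S \<Longrightarrow> f x = 0"
    and cont: "\<And>x y. x \<in> S \<Longrightarrow> y < r \<Longrightarrow> continuous_on {x..y} f"
    and deriv: "\<And>x. x \<in> {l<..<r} \<Longrightarrow> (f has_real_derivative u x) (at x)"
  shows "\<exists>R. finite R \<and> R \<subseteq> {l<..<r} - S \<and> (\<forall>x\<in>R. u x = 0) \<and> card S \<le> card R + 1 \<and>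
             (\<forall>x\<in>R. \<exists>y\<in>S. x < y)"
  using assms(1-4)
proof (induction S rule: finite_linorder_max_induct)
  case empty
  then show ?case by (intro exI[of _ "{}"]) auto
next
  case (insert b S)
  then obtain R where R: "finite R" "R \<subseteq> {l<..<r} - S" "\<forall>x\<in>R. u x = 0" "card S \<le> card R + 1"
      "\<forall>x\<in>R. \<exists>y\<in>S. x < y"
    by auto
  show ?case
  proof (cases "S = {}")
    case True
    then show ?thesis by (intro exI[of _ "{}"]) auto
  next
    case False
    define a where "a = Max S"
    have a: "a \<in> S" "\<forall>x\<in>S. x \<le> a"
      using False insert.hyps by (auto simp: a_def)
    have "a < b" using a insert.hyps by auto
    have ab: "a \<in> {l..<r}" "b \<in> {l..<r}" using a insert.prems by auto
    have "f a = f b" using a(1) insert.prems(2)[of a] insert.prems(2)[of b] by auto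
    moreover have "continuous_on {a..b} f" using insert.prems(3)[of a b] a(1) ab by auto
    ultimately obtain z where z: "a < z" "z < b" "(f has_derivative (\<lambda>v. 0)) (at z)"
      using Rolle_deriv[of a b f "\<lambda>x v. u x * v"] \<open>a < b\<close> deriv ab
      by (smt (verit) Rolle has_field_derivative_def deriv DERIV_isCont real_differentiable_def greaterThanLessThan_iff atLeastLessThan_iff)
    have "u z = 0"
    proof -
      have "(f has_real_derivative 0) (at z)"
        using z(3) by (simp add: has_field_derivative_def lambda_zero)
      then show ?thesis using z ab deriv[of z] DERIV_unique[of f "u z" z 0] by auto
    qed
    have "z \<notin> R" using R(5) a(2) z by force
    show ?thesis
    proof (intro exI[of _ "insert z R"] conjI)
      show "insert z R \<subseteq> {l<..<r} - insert b S"
        using R(2,5) z ab a(2) insert.hyps(2) by force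
      show "card (insert b S) \<le> card (insert z R) + 1"
        using R(1,4) \<open>z \<notin> R\<close> insert.hyps by (simp add: card_insert_if)
      show "\<forall>x\<in>insert z R. \<exists>y\<in>insert b S. x < y"
        using R(5) z by auto
    qed (use R \<open>u z = 0\<close> in auto)
  qed
qed

text \<open>Rolle's theorem with multiplicities. The zeros of \<open>u\<close> counted in the proof are of two kinds:
  a zero of \<open>f\<close> of multiplicity \<open>\<mu>\<close> contributes \<open>\<mu> - 1\<close>, and every Rolle point in between contributes at least one.
  The parameter \<open>k\<close> is the number of zeros lost: one in general, none if \<open>f\<close> also vanishes at an end point.\<close>
lemma at_most_zeros_on_from_derivative:
  fixes f u :: "real \<Rightarrow> real"
  assumes deriv: "\<And>x. x \<in> {l<..<r} \<Longrightarrow> (f has_real_derivative u x) (at x)"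
    and an: "\<And>x. x \<in> {l<..<r} \<Longrightarrow> analytic_at_real u x"
    and u: "at_most_zeros_on n u {l<..<r}"
    and rolle: "\<And>S. finite S \<Longrightarrow> S \<subseteq> {x\<in>{l<..<r}. f x = 0} \<Longrightarrow>
      \<exists>R. finite R \<and> R \<subseteq> {l<..<r} - S \<and> (\<forall>x\<in>R. u x = 0) \<and> card S \<le> card R + k"
  shows "at_most_zeros_on (n + k) f {l<..<r}"
proof -
  let ?L = "{l<..<r}" and ?Z = "{x\<in>{l<..<r}. f x = 0}" and ?U = "{x\<in>{l<..<r}. u x = 0}"
  have finU: "finite ?U" and sumU: "(\<Sum>x\<in>?U. zero_multiplicity u x) \<le> n"
    using u unfolding at_most_zeros_on_def by auto
  have pos: "zero_multiplicity u x \<ge> 1" if "x \<in> ?U" for x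
    using zero_multiplicity_pos[OF an finU] that by auto
  have mult: "zero_multiplicity f x \<le> Suc (zero_multiplicity u x)" if "x \<in> ?Z" for x
  proof -
    have "eventually (\<lambda>y. y \<in> ?L) (nhds x)"
      using that by (intro eventually_nhds_in_open) auto
    then have "eventually (\<lambda>y. deriv f y = u y) (nhds x)"
      by eventually_elim (use deriv DERIV_imp_deriv in auto)
    from zero_multiplicity_cong[OF this] show ?thesis
      using zero_multiplicity_le_Suc_deriv[of f x] that by auto
  qed
  have bound: "(\<Sum>x\<in>S. zero_multiplicity f x) \<le> n + k \<and> card S \<le> card ?U + k"
    if S: "finite S" "S \<subseteq> ?Z" for S
  proof -
    obtain R where R: "finite R" "R \<subseteq> ?L - S" "\<forall>x\<in>R. u x = 0" "card S \<le> card R + k"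
      using rolle[OF S] by blast
    have RU: "R \<subseteq> ?U" using R by auto
    have "zero_multiplicity u x = 0" if "x \<in> S - ?U" for x
      using that S unfolding zero_multiplicity_def by (intro Least_eq_0) auto
    then have "(\<Sum>x\<in>S. zero_multiplicity u x) = (\<Sum>x\<in>S \<inter> ?U. zero_multiplicity u x)"
      using S by (intro sum.mono_neutral_right) auto
    moreover have "card R \<le> (\<Sum>x\<in>R. zero_multiplicity u x)"
      using sum_mono[of R "\<lambda>_. 1" "zero_multiplicity u"] pos RU by auto
    moreover have "(\<Sum>x\<in>S \<inter> ?U. zero_multiplicity u x) + (\<Sum>x\<in>R. zero_multiplicity u x)
        = (\<Sum>x\<in>(S \<inter> ?U) \<union> R. zero_multiplicity u x)"
      using R S by (intro sum.union_disjoint[symmetric]) auto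
    moreover have "\<dots> \<le> (\<Sum>x\<in>?U. zero_multiplicity u x)"
      using finU RU by (intro sum_mono2) auto
    moreover have "(\<Sum>x\<in>S. zero_multiplicity f x) \<le> (\<Sum>x\<in>S. zero_multiplicity u x + 1)"
      using mult S by (intro sum_mono) auto
    moreover have "(\<Sum>x\<in>S. zero_multiplicity u x + 1) = (\<Sum>x\<in>S. zero_multiplicity u x) + card S"
      by (subst sum.distrib) simp
    moreover have "card R \<le> card ?U"
      using card_mono[OF finU RU] .
    ultimately show ?thesis using R(4) sumU by linarith
  qed
  have "finite ?Z"
    using finite_if_finite_subsets_card_bdd[of ?Z "card ?U + k"] bound by blast
  then show ?thesis
    using bound[of ?Z] unfolding at_most_zeros_on_def by auto
qed

lemma at_most_zeros_on_Rolle: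
  fixes f u :: "real \<Rightarrow> real"
  assumes deriv: "\<And>x. x \<in> {l<..<r} \<Longrightarrow> (f has_real_derivative u x) (at x)"
    and an: "\<And>x. x \<in> {l<..<r} \<Longrightarrow> analytic_at_real u x"
    and u: "at_most_zeros_on n u {l<..<r}"
  shows "at_most_zeros_on (Suc n) f {l<..<r}"
proof -
  have "\<exists>R. finite R \<and> R \<subseteq> {l<..<r} - S \<and> (\<forall>x\<in>R. u x = 0) \<and> card S \<le> card R + 1"
    if S: "finite S" "S \<subseteq> {x\<in>{l<..<r}. f x = 0}" for S
  proof -
    have "continuous_on {x..y} f" if "x \<in> S" "y < r" for x y
    proof (intro DERIV_atLeastAtMost_imp_continuous_on)
      fix z assume "x \<le> z" "z \<le> y"
      then have "z \<in> {l<..<r}" using that S by force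
      then show "\<exists>y. (f has_real_derivative y) (at z)" using deriv by blast
    qed
    moreover have "S \<subseteq> {l..<r}" "\<And>x. x \<in> S \<Longrightarrow> f x = 0" using S(2) by auto
    ultimately show ?thesis
      using rolle_points[OF S(1), of l r f u] deriv by blast
  qed
  from at_most_zeros_on_from_derivative[OF deriv an u this] show ?thesis by simp
qed

lemma at_most_zeros_on_Rolle_left_end:
  fixes f u :: "real \<Rightarrow> real"
  assumes deriv: "\<And>x. x \<in> {l<..<r} \<Longrightarrow> (f has_real_derivative u x) (at x)"
    and an: "\<And>x. x \<in> {l<..<r} \<Longrightarrow> analytic_at_real u x"
    and u: "at_most_zeros_on n u {l<..<r}"
    and lim: "(f \<longlongrightarrow> 0) (at_right l)"
  shows "at_most_zeros_on n f {l<..<r}"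
proof -
  have "\<exists>R. finite R \<and> R \<subseteq> {l<..<r} - S \<and> (\<forall>x\<in>R. u x = 0) \<and> card S \<le> card R + 0"
    if S: "finite S" "S \<subseteq> {x\<in>{l<..<r}. f x = 0}" for S
  proof (cases "S = {}")
    case True
    then show ?thesis by (intro exI[of _ "{}"]) auto
  next
    case False
    then have "l < r" using S by auto
    define f0 where "f0 = (\<lambda>x. if x \<le> l then 0 else f x)"
    have d: "(f0 has_real_derivative u x) (at x)" if "x \<in> {l<..<r}" for x
    proof -
      have "eventually (\<lambda>y. y \<in> {l<..<r}) (nhds x)"
        using that by (intro eventually_nhds_in_open) auto
      then have "eventually (\<lambda>y. f0 y = f y) (nhds x)"
        by eventually_elim (auto simp: f0_def)
      with deriv[OF that] show ?thesis by (simp add: DERIV_cong_ev)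
    qed
    have "eventually (\<lambda>y. f0 y = f y) (at_right l)"
      by (simp add: eventually_at_filter f0_def)
    then have l0: "(f0 \<longlongrightarrow> f0 l) (at_right l)"
      using lim by (simp add: tendsto_cong f0_def)
    have "continuous_on {x..y} f0" if "x \<in> insert l S" "y < r" for x y
      unfolding continuous_on_def
    proof
      fix z assume z: "z \<in> {x..y}"
      show "(f0 \<longlongrightarrow> f0 z) (at z within {x..y})"
      proof (cases "z = l")
        case True
        have "at z within {x..y} \<le> at_right l"
          using True z that S(2) by (auto simp: at_within_def intro!: le_infI2)
        then show ?thesis using l0 True tendsto_mono by blast
      next
        case False
        then have "z \<in> {l<..<r}" using z that S(2) by auto
        then show ?thesis using d DERIV_isCont isCont_def tendsto_within_subset by blast
      qed
    qed
    moreover have "f0 x = 0" if "x \<in> insert l S" for x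
      using that S by (auto simp: f0_def)
    moreover have "finite (insert l S)" "insert l S \<subseteq> {l..<r}" using S \<open>l < r\<close> by auto
    ultimately obtain R where "finite R" "R \<subseteq> {l<..<r} - insert l S" "\<forall>x\<in>R. u x = 0"
        "card (insert l S) \<le> card R + 1"
      using rolle_points[of "insert l S" l r f0 u] d by blast
    moreover have "card (insert l S) = card S + 1"
      using S by (subst card_insert_disjoint) auto
    ultimately show ?thesis by (intro exI[of _ R]) auto
  qed
  from at_most_zeros_on_from_derivative[OF deriv an u this] show ?thesis by simp
qed

lemma at_most_zeros_on_0: "(\<And>x. x \<in> L \<Longrightarrow> f x \<noteq> 0) \<Longrightarrow> at_most_zeros_on 0 f L"
proof -
  assume "\<And>x. x \<in> L \<Longrightarrow> f x \<noteq> 0"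
  then have "{x \<in> L. f x = 0} = {}" by auto
  then show ?thesis unfolding at_most_zeros_on_def by (metis finite.emptyI sum.empty le_refl)
qed

lemma at_most_zeros_on_mono: "at_most_zeros_on m f L \<Longrightarrow> m \<le> n \<Longrightarrow> at_most_zeros_on n f L"
  unfolding at_most_zeros_on_def by linarith

lemma at_most_zeros_on_restrict:
  assumes "at_most_zeros_on n f L'" "L' \<subseteq> L" "\<And>x. x \<in> L - L' \<Longrightarrow> f x \<noteq> 0"
  shows "at_most_zeros_on n f L"
proof -
  have "{x \<in> L. f x = 0} = {x \<in> L'. f x = 0}" using assms by auto
  then show ?thesis using assms unfolding at_most_zeros_on_def by simp
qed

lemma pos_if_increasing_from_zero:
  fixes f f' :: "real \<Rightarrow> real"
  assumes "\<And>x. x \<in> {l<..<r} \<Longrightarrow> (f has_real_derivative f' x) (at x)"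
    and "\<And>x. x \<in> {l<..<r} \<Longrightarrow> f' x > 0" and lim: "(f \<longlongrightarrow> 0) (at_right l)"
    and x: "x \<in> {l<..<r}"
  shows "f x > 0"
proof -
  have mono: "f y < f z" if "l < y" "y < z" "z < r" for y z
    by (rule DERIV_pos_imp_increasing[OF \<open>y < z\<close>]) (use assms(1,2) that in \<open>meson greaterThanLessThan_iff le_less_trans less_le_trans\<close>)
  define m where "m = (l + x) / 2"
  have m: "l < m" "m < x" using x by (auto simp: m_def)
  have "eventually (\<lambda>y. f y \<le> f m) (at_right l)"
    using eventually_at_right_real[OF m(1)]
    by eventually_elim (use mono m x in \<open>auto intro!: less_imp_le\<close>)
  then have "0 \<le> f m" using tendsto_upperbound[OF lim] by simp
  then show ?thesis using mono[of m x] m x by auto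
qed

section \<open>Zeros of combinations of solutions of the Picard-Fuchs system\<close>

text \<open>In the application \<open>X\<close>, \<open>Y\<close>, \<open>Z\<close> are the integrals of \<open>(x + 1) ^ k y dx\<close> over the oval of level \<open>h\<close>
  for \<open>k = -3, -2, -1\<close>, and \<open>K\<close> is the integral of \<open>(x + 1) dx / y\<close>. The pair \<open>(Y, K)\<close> solves a closed system of
  hypergeometric type; \<open>X\<close> and \<open>Z\<close>, which have residues at \<open>x = -1\<close>, solve first-order equations over it.
  The level \<open>0\<close> is the centre and the level \<open>1/6\<close> the saddle loop.\<close>
locale annulus_integrals =
  fixes X Y Z K :: "real \<Rightarrow> real"
  assumes X_deriv: "h \<in> {0<..<1/6} \<Longrightarrow> (X has_real_derivative (3 * X h + Y h + K h) / (1 - 6 * h)) (at h)"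
    and Y_deriv: "h \<in> {0<..<1/6} \<Longrightarrow> (Y has_real_derivative K h / (1 - 6 * h)) (at h)"
    and Z_deriv: "h \<in> {0<..<1/6} \<Longrightarrow> (Z has_real_derivative (K h - 3 * Z h) / (1 - 6 * h)) (at h)"
    and K_deriv: "h \<in> {0<..<1/6} \<Longrightarrow> (K has_real_derivative - Y h / (6 * h)) (at h)"
    and pos: "h \<in> {0<..<1/6} \<Longrightarrow> X h > 0" "h \<in> {0<..<1/6} \<Longrightarrow> Y h > 0" "h \<in> {0<..<1/6} \<Longrightarrow> K h > 0"
    and analytic: "h \<in> {0<..<1/6} \<Longrightarrow> analytic_at_real X h" "h \<in> {0<..<1/6} \<Longrightarrow> analytic_at_real Y h"
        "h \<in> {0<..<1/6} \<Longrightarrow> analytic_at_real Z h" "h \<in> {0<..<1/6} \<Longrightarrow> analytic_at_real K h"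
    and lim0: "(X \<longlongrightarrow> 0) (at_right 0)" "(Y \<longlongrightarrow> 0) (at_right 0)" "(Z \<longlongrightarrow> 0) (at_right 0)"
        "((\<lambda>h. h * K h) \<longlongrightarrow> 0) (at_right 0)"
    and Y_le: "\<exists>C. \<forall>h\<in>{0<..1/12}. Y h \<le> C * h"
begin

text \<open>The quotient \<open>K / Y\<close> has a simple pole at the centre. Subtracting \<open>(1 - 6 h) / h\<close> leaves a
  bounded function, whose limit at the centre is \<open>35/12\<close>.\<close>
definition D :: "real \<Rightarrow> real" where
  "D h = K h / Y h - (1 - 6 * h) / h"

lemma K_eq: "h \<in> {0<..<1/6} \<Longrightarrow> K h = Y h * ((1 - 6 * h) / h + D h)"
  using pos(2)[of h] by (simp add: D_def)

text \<open>The expression vanishes at the centre and its derivative is \<open>35/6 Y\<close>.\<close>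
lemma D_numerator_pos:
  assumes "h \<in> {0<..<1/6}"
  shows "h * K h - (1 - 6 * h) * Y h > 0"
proof (rule pos_if_increasing_from_zero[OF _ _ _ assms])
  fix h :: real assume h: "h \<in> {0<..<1/6}"
  show "((\<lambda>h. h * K h - (1 - 6 * h) * Y h) has_real_derivative 35 / 6 * Y h) (at h)"
    using h by (auto intro!: derivative_eq_intros K_deriv Y_deriv simp: divide_simps)
  show "35 / 6 * Y h > 0" using pos h by simp
next
  have "((\<lambda>h. h * K h - (1 - 6 * h) * Y h) \<longlongrightarrow> 0 - (1 - 6 * 0) * 0) (at_right 0)"
    by (intro tendsto_intros lim0)
  then show "((\<lambda>h. h * K h - (1 - 6 * h) * Y h) \<longlongrightarrow> 0) (at_right 0)" by simp
qed

lemma D_pos: "h \<in> {0<..<1/6} \<Longrightarrow> D h > 0"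
  using D_numerator_pos[of h] pos(2)[of h] by (simp add: D_def field_simps)

text \<open>Again a comparison from the centre: the derivative of \<open>35 h Y - 12 h Y D\<close> is a positive multiple of
  the numerator of \<open>D\<close>.\<close>
lemma D_upper:
  assumes "h \<in> {0<..<1/6}"
  shows "D h < 35 / 12"
proof -
  have "35 * (h * Y h) - 12 * (h * K h - (1 - 6 * h) * Y h) > 0"
  proof (rule pos_if_increasing_from_zero[OF _ _ _ assms])
    fix h :: real assume h: "h \<in> {0<..<1/6}"
    show "((\<lambda>h. 35 * (h * Y h) - 12 * (h * K h - (1 - 6 * h) * Y h)) has_real_derivative
        35 * (h * K h - (1 - 6 * h) * Y h) / (1 - 6 * h)) (at h)"
      using h by (auto intro!: derivative_eq_intros K_deriv Y_deriv simp: divide_simps)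
    show "35 * (h * K h - (1 - 6 * h) * Y h) / (1 - 6 * h) > 0"
      using D_numerator_pos[OF h] h by simp
  next
    have "((\<lambda>h. 35 * (h * Y h) - 12 * (h * K h - (1 - 6 * h) * Y h)) \<longlongrightarrow> 35 * (0 * 0) - 12 * (0 - (1 - 6 * 0) * 0)) (at_right 0)"
      by (intro tendsto_intros lim0)
    then show "((\<lambda>h. 35 * (h * Y h) - 12 * (h * K h - (1 - 6 * h) * Y h)) \<longlongrightarrow> 0) (at_right 0)" by simp
  qed
  then show ?thesis
    using pos(2)[of h] assms by (simp add: D_def field_simps)
qed

text \<open>This is the derivative of \<open>D\<close> with respect to the variable \<open>m = (1 - 6 h) / (6 h)\<close>, expressed through
  the Riccati equation of \<open>K / Y\<close>.\<close>
definition s :: "real \<Rightarrow> real" where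
  "s h = - 35 * h + 12 * h * D h + 6 * h\<^sup>2 * (D h)\<^sup>2 / (1 - 6 * h)"

lemma D_deriv:
  assumes h: "h \<in> {0<..<1/6}"
  shows "(D has_real_derivative - s h / (6 * h\<^sup>2)) (at h)"
proof -
  have Y: "Y h \<noteq> 0" and t: "1 - 6 * h \<noteq> 0" "h \<noteq> 0" using pos(2)[OF h] h by auto
  define r where "r = (1 - 6 * h) / h + D h"
  have "(D has_real_derivative
      ((- Y h / (6 * h)) * Y h - K h * (K h / (1 - 6 * h))) / (Y h * Y h) - ((- 6) * h - (1 - 6 * h) * 1) / (h * h)) (at h)"
    unfolding D_def [abs_def] using Y t
    by (intro DERIV_diff DERIV_divide K_deriv Y_deriv h) (auto intro!: derivative_eq_intros)
  also have "((- Y h / (6 * h)) * Y h - K h * (K h / (1 - 6 * h))) / (Y h * Y h)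
      = - 1 / (6 * h) - r\<^sup>2 / (1 - 6 * h)"
    unfolding K_eq[OF h] r_def[symmetric] using Y t by (simp add: field_simps power2_eq_square)
  also have "- 1 / (6 * h) - r\<^sup>2 / (1 - 6 * h) - ((- 6) * h - (1 - 6 * h) * 1) / (h * h) = - s h / (6 * h\<^sup>2)"
    unfolding r_def s_def using t by (simp add: divide_simps power2_eq_square) algebra
  finally show ?thesis .
qed

lemma s_deriv:
  assumes h: "h \<in> {0<..<1/6}"
  shows "(s has_real_derivative (2 * (3 - D h) * s h + (35 - 12 * D h)) / (1 - 6 * h)) (at h)"
proof -
  have t: "1 - 6 * h \<noteq> 0" "h \<noteq> 0" using h by auto
  define D' where "D' = - s h / (6 * h\<^sup>2)"
  have "(s has_real_derivative - 35 + (12 * D h + 12 * h * D') +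
      ((12 * h * (D h)\<^sup>2 + 6 * h\<^sup>2 * (2 * D h * D')) * (1 - 6 * h) - 6 * h\<^sup>2 * (D h)\<^sup>2 * (- 6)) / ((1 - 6 * h) * (1 - 6 * h))) (at h)"
    unfolding s_def [abs_def]
    by (rule derivative_eq_intros D_deriv[OF h, folded D'_def] t refl)+
       (use t in \<open>simp add: divide_simps power2_eq_square; algebra\<close>)
  also have "- 35 + (12 * D h + 12 * h * D') +
      ((12 * h * (D h)\<^sup>2 + 6 * h\<^sup>2 * (2 * D h * D')) * (1 - 6 * h) - 6 * h\<^sup>2 * (D h)\<^sup>2 * (- 6)) / ((1 - 6 * h) * (1 - 6 * h))
      = (2 * (3 - D h) * s h + (35 - 12 * D h)) / (1 - 6 * h)"
    unfolding D'_def s_def using t by (simp add: divide_simps power2_eq_square) algebra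
  finally show ?thesis .
qed

text \<open>The equation of \<open>s\<close> is linear with the positive inhomogeneity \<open>35 - 12 D\<close>. Its integrating factor
  \<open>(1 - 6 h) Y\<^sup>2 / h\<^sup>2\<close> is explicit because \<open>D\<close> differs from \<open>(1 - 6 h) Y' / Y\<close> by an elementary function, and
  it stays bounded at the centre, where \<open>s\<close> vanishes.\<close>
lemma s_pos:
  assumes "h \<in> {0<..<1/6}"
  shows "s h > 0"
proof -
  define mu where "mu = (\<lambda>h. (1 - 6 * h) * (Y h)\<^sup>2 / h\<^sup>2)"
  have mu_pos: "mu h > 0" if "h \<in> {0<..<1/6}" for h
    using that pos(2)[OF that] by (simp add: mu_def)
  have mu_deriv: "(mu has_real_derivative mu h * ((2 * D h - 6) / (1 - 6 * h))) (at h)"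
    if h: "h \<in> {0<..<1/6}" for h
  proof -
    have t: "1 - 6 * h \<noteq> 0" "h \<noteq> 0" using h by auto
    have "(mu has_real_derivative (((- 6) * (Y h)\<^sup>2 + (1 - 6 * h) * (2 * Y h * (K h / (1 - 6 * h)))) * h\<^sup>2
        - (1 - 6 * h) * (Y h)\<^sup>2 * (2 * h)) / (h\<^sup>2 * h\<^sup>2)) (at h)"
      unfolding mu_def
      by (rule derivative_eq_intros Y_deriv h refl)+
         (use t in \<open>simp_all add: power2_eq_square\<close>)
    also have "(((- 6) * (Y h)\<^sup>2 + (1 - 6 * h) * (2 * Y h * (K h / (1 - 6 * h)))) * h\<^sup>2
        - (1 - 6 * h) * (Y h)\<^sup>2 * (2 * h)) / (h\<^sup>2 * h\<^sup>2) = mu h * ((2 * D h - 6) / (1 - 6 * h))"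
      unfolding K_eq[OF h] mu_def using t by (simp add: divide_simps power2_eq_square) algebra
    finally show ?thesis .
  qed
  have "mu h * s h > 0"
  proof (rule pos_if_increasing_from_zero[OF _ _ _ assms])
    fix h :: real assume h: "h \<in> {0<..<1/6}"
    have "((\<lambda>h. mu h * s h) has_real_derivative mu h * ((2 * D h - 6) / (1 - 6 * h)) * s h
        + (2 * (3 - D h) * s h + (35 - 12 * D h)) / (1 - 6 * h) * mu h) (at h)"
      by (rule DERIV_mult[OF mu_deriv[OF h] s_deriv[OF h]])
    also have "mu h * ((2 * D h - 6) / (1 - 6 * h)) * s h
        + (2 * (3 - D h) * s h + (35 - 12 * D h)) / (1 - 6 * h) * mu h = mu h * (35 - 12 * D h) / (1 - 6 * h)"
      using h by (simp add: divide_simps) algebra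
    finally show "((\<lambda>h. mu h * s h) has_real_derivative mu h * (35 - 12 * D h) / (1 - 6 * h)) (at h)" .
    show "mu h * (35 - 12 * D h) / (1 - 6 * h) > 0"
      using mu_pos[OF h] D_upper[OF h] h by (simp add: divide_simps)
  next
    obtain C where C: "\<And>h. h \<in> {0<..1/12} \<Longrightarrow> Y h \<le> C * h" using Y_le by blast
    have "eventually (\<lambda>h::real. h \<in> {0<..<1/12}) (at_right 0)"
      by (rule eventually_at_right_real) simp
    then have "eventually (\<lambda>h. norm (mu h * s h) \<le> C\<^sup>2 * (125 * h)) (at_right 0)"
    proof eventually_elim
      case (elim h)
      then have h: "h \<in> {0<..<1/6}" and h1: "0 < h" "h < 1/12" by auto
      have t: "1 - 6 * h \<noteq> 0" "h \<noteq> 0" using h by auto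
      have D: "0 \<le> D h" "D h \<le> 3" using D_pos[OF h] D_upper[OF h] by auto
      have Y2: "(Y h / h)\<^sup>2 \<le> C\<^sup>2"
        using C[of h] h1 pos(2)[OF h] by (intro power_mono) (auto simp: field_simps)
      have s: "\<bar>(1 - 6 * h) * s h\<bar> \<le> 125 * h"
      proof -
        have "(1 - 6 * h) * s h = h * (- 35 * (1 - 6 * h) + 12 * (1 - 6 * h) * D h + 6 * h * (D h)\<^sup>2)"
          unfolding s_def using t by (simp add: field_simps power2_eq_square)
        also have "\<bar>\<dots>\<bar> \<le> h * 125"
        proof -
          \<comment> \<open>Any constant would do in place of \<open>125\<close>.\<close>
          have bound: "\<bar>- 35 * (1 - 6 * h) + 12 * p + 6 * q\<bar> \<le> 125"
            if "0 \<le> p" "p \<le> 1 * 3" "0 \<le> q" "q \<le> (1/12) * 3\<^sup>2" for p q :: real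
            using that h1 by (simp add: abs_le_iff)
          have "\<bar>- 35 * (1 - 6 * h) + 12 * ((1 - 6 * h) * D h) + 6 * (h * (D h)\<^sup>2)\<bar> \<le> 125"
            using D h1 by (intro bound mult_mono power_mono mult_nonneg_nonneg) auto
          then have "\<bar>- 35 * (1 - 6 * h) + 12 * (1 - 6 * h) * D h + 6 * h * (D h)\<^sup>2\<bar> \<le> 125"
            by (simp only: mult.assoc)
          then show ?thesis using h1 by (simp add: abs_mult mult_left_mono)
        qed
        finally show ?thesis by simp
      qed
      have "mu h * s h = (Y h / h)\<^sup>2 * ((1 - 6 * h) * s h)"
        unfolding mu_def by (simp add: power_divide)
      then have norm_eq: "norm (mu h * s h) = (Y h / h)\<^sup>2 * \<bar>(1 - 6 * h) * s h\<bar>"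
        by (simp only: real_norm_def abs_mult abs_power2)
      show ?case
        unfolding norm_eq using Y2 s by (intro mult_mono) auto
    qed
    moreover have "((\<lambda>h. C\<^sup>2 * (125 * h)) \<longlongrightarrow> C\<^sup>2 * (125 * 0)) (at_right (0::real))"
      by (intro tendsto_intros)
    then have "((\<lambda>h. C\<^sup>2 * (125 * h)) \<longlongrightarrow> 0) (at_right (0::real))" by simp
    ultimately show "((\<lambda>h. mu h * s h) \<longlongrightarrow> 0) (at_right 0)"
      by (rule Lim_null_comparison)
  qed
  then show ?thesis using mu_pos[OF assms] by (simp add: zero_less_mult_iff)
qed

text \<open>Since \<open>m\<close> decreases with \<open>h\<close>, this says that \<open>D\<close> is strictly concave as a function of \<open>m\<close>.\<close>
lemma s_strict_mono:
  assumes "x \<in> {0<..<1/6}" "y \<in> {0<..<1/6}" "x < y"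
  shows "s x < s y"
proof (rule DERIV_pos_imp_increasing[OF \<open>x < y\<close>])
  fix z assume "x \<le> z" "z \<le> y"
  then have z: "z \<in> {0<..<1/6}" using assms by auto
  have "2 * (3 - D z) * s z + (35 - 12 * D z) > 0"
    using s_pos[OF z] D_upper[OF z] by (intro add_pos_pos mult_pos_pos) auto
  then have "(2 * (3 - D z) * s z + (35 - 12 * D z)) / (1 - 6 * z) > 0"
    using z by simp
  then show "\<exists>d. (s has_real_derivative d) (at z) \<and> d > 0"
    using s_deriv[OF z] by blast
qed

text \<open>\<open>K\<close> is bounded near the saddle loop, so \<open>Y\<close> grows at most logarithmically there.\<close>
lemma Y_sqrt_tendsto_0: "((\<lambda>h. sqrt (1 - 6 * h) * Y h) \<longlongrightarrow> 0) (at_left (1/6))"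
  and K_sqrt_tendsto_0: "((\<lambda>h. sqrt (1 - 6 * h) * K h) \<longlongrightarrow> 0) (at_left (1/6))"
proof -
  define C where "C = K (1/12)"
  have K_le: "K h \<le> C" if "h \<in> {1/12..<1/6}" for h
  proof -
    have "C \<ge> K h" unfolding C_def
    proof (rule DERIV_nonpos_imp_nonincreasing[of "1/12" h])
      fix x assume "1/12 \<le> x" "x \<le> h"
      then have x: "x \<in> {0<..<1/6}" using that by auto
      show "\<exists>y. (K has_real_derivative y) (at x) \<and> y \<le> 0"
        using K_deriv[OF x] pos(2)[OF x] x
        by (intro exI[of _ "- Y x / (6 * x)"]) (auto intro!: divide_nonpos_pos)
    qed (use that in auto)
    then show ?thesis .
  qed
  have "C > 0" using pos(3)[of "1/12"] by (simp add: C_def)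
  define c0 where "c0 = Y (1/12) + C / 6 * ln (1/2)"
  have Y_le_ln: "Y h \<le> c0 - C / 6 * ln (1 - 6 * h)" if "h \<in> {1/12<..<1/6}" for h
  proof -
    have "Y (1/12) + C / 6 * ln (1 - 6 * (1/12)) \<ge> Y h + C / 6 * ln (1 - 6 * h)"
    proof (rule DERIV_nonpos_imp_nonincreasing[of "1/12" h])
      fix x assume x12: "1/12 \<le> x" "x \<le> h"
      then have x: "x \<in> {0<..<1/6}" using that by auto
      have "((\<lambda>x. Y x + C / 6 * ln (1 - 6 * x)) has_real_derivative (K x - C) / (1 - 6 * x)) (at x)"
        using x by (auto intro!: derivative_eq_intros Y_deriv simp: diff_divide_distrib)
          (simp add: divide_simps)
      moreover have "K x \<le> C" using K_le[of x] x12 x by simp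
      then have "(K x - C) / (1 - 6 * x) \<le> 0" using x by (intro divide_nonpos_pos) auto
      ultimately show "\<exists>y. ((\<lambda>x. Y x + C / 6 * ln (1 - 6 * x)) has_real_derivative y) (at x) \<and> y \<le> 0"
        by blast
    qed (use that in auto)
    then show ?thesis by (simp add: c0_def)
  qed
  have ev: "eventually (\<lambda>h. h \<in> {1/12<..<1/6}) (at_left (1/6::real))"
    by (rule eventually_at_left_real) simp
  have sq: "((\<lambda>h. sqrt (1 - 6 * h)) \<longlongrightarrow> sqrt (1 - 6 * (1/6))) (at_left (1/6))"
    by (intro tendsto_intros)
  have sq2: "((\<lambda>h. \<bar>c0\<bar> * sqrt (1 - 6 * h) + C * sqrt (sqrt (1 - 6 * h))) \<longlongrightarrow>
      \<bar>c0\<bar> * sqrt (1 - 6 * (1/6)) + C * sqrt (sqrt (1 - 6 * (1/6)))) (at_left (1/6))"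
    by (intro tendsto_intros)
  have "eventually (\<lambda>h. norm (sqrt (1 - 6 * h) * Y h) \<le> \<bar>c0\<bar> * sqrt (1 - 6 * h) + C * sqrt (sqrt (1 - 6 * h)))
      (at_left (1/6))"
    using ev
  proof eventually_elim
    case (elim h)
    then have h: "h \<in> {0<..<1/6}" by auto
    define w where "w = sqrt (sqrt (1 - 6 * h))"
    have w: "w > 0" and ww: "sqrt (1 - 6 * h) = w * w" using h by (auto simp: w_def)
    have "ln (1 - 6 * h) = 4 * ln w" using h by (simp add: w_def ln_sqrt)
    moreover have "ln (1 / w) \<le> 1 / w" using w ln_le_minus_one[of "1 / w"] by simp
    ultimately have "- ln (1 - 6 * h) \<le> 4 / w" using w by (simp add: ln_div)
    then have "C / 6 * (- ln (1 - 6 * h)) \<le> C / 6 * (4 / w)"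
      using \<open>C > 0\<close> by (intro mult_left_mono) auto
    also have "\<dots> \<le> C / w" using \<open>C > 0\<close> w by (simp add: field_simps)
    finally have "Y h \<le> \<bar>c0\<bar> + C / w" using Y_le_ln[OF elim] by simp
    then have "w * w * Y h \<le> w * w * (\<bar>c0\<bar> + C / w)" using w by (intro mult_left_mono) auto
    also have "\<dots> = \<bar>c0\<bar> * (w * w) + C * w" using w by (simp add: field_simps)
    finally have "w * w * Y h \<le> \<bar>c0\<bar> * (w * w) + C * w" .
    moreover have "0 \<le> w * w * Y h" using w pos(2)[OF h] by simp
    ultimately show ?case using w unfolding ww by (simp flip: w_def)
  qed
  moreover have "((\<lambda>h. \<bar>c0\<bar> * sqrt (1 - 6 * h) + C * sqrt (sqrt (1 - 6 * h))) \<longlongrightarrow> 0) (at_left (1/6))"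
    using sq2 by simp
  ultimately show "((\<lambda>h. sqrt (1 - 6 * h) * Y h) \<longlongrightarrow> 0) (at_left (1/6))"
    by (rule Lim_null_comparison)
  have "eventually (\<lambda>h. norm (sqrt (1 - 6 * h) * K h) \<le> sqrt (1 - 6 * h) * C) (at_left (1/6))"
    using ev
  proof eventually_elim
    case (elim h)
    then show ?case using K_le[of h] pos(3)[of h] by (auto simp: abs_mult intro!: mult_left_mono)
  qed
  moreover have "((\<lambda>h. sqrt (1 - 6 * h) * C) \<longlongrightarrow> 0) (at_left (1/6))"
    using tendsto_mult_right[OF sq, of C] by simp
  ultimately show "((\<lambda>h. sqrt (1 - 6 * h) * K h) \<longlongrightarrow> 0) (at_left (1/6))"
    by (rule Lim_null_comparison)
qed

text \<open>With \<open>F = a X + b Y + c Z\<close>, this is \<open>(1 - 6 h) F' + 3 F\<close>, which no longer contains \<open>Z\<close>.\<close>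
definition P :: "real \<Rightarrow> real \<Rightarrow> real \<Rightarrow> real \<Rightarrow> real" where
  "P a b c h = a * (6 * X h + K h + Y h) + b * (K h + 3 * Y h) + c * K h"

text \<open>Up to the factor \<open>Y\<close> this is \<open>(1 - 6 h) P' - 3 P\<close>, from which \<open>X\<close> has disappeared as well. The coefficient
  \<open>23 a - b - 19 c\<close> collects the multiples of \<open>(1 - 6 h) / (6 h)\<close>, including those that
  arise from replacing \<open>K\<close> by \<open>Y\<close> and \<open>D\<close>.\<close>
definition g :: "real \<Rightarrow> real \<Rightarrow> real \<Rightarrow> real \<Rightarrow> real" where
  "g a b c h = (3 * a - 9 * b) + (23 * a - b - 19 * c) * ((1 - 6 * h) / (6 * h)) + (4 * a - 3 * c) * D h"

lemma sqrt_deriv: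
  "h \<in> {0<..<1/6} \<Longrightarrow> ((\<lambda>h. sqrt (1 - 6 * h)) has_real_derivative - 3 / sqrt (1 - 6 * h)) (at h)"
  by (auto intro!: derivative_eq_intros simp: field_simps)

lemma analytic_sqrt: "h \<in> {0<..<1/6} \<Longrightarrow> analytic_at_real (\<lambda>h. sqrt (1 - 6 * h)) h"
  using analytic_at_real_sqrt_affine[of 1 "-6" h] by simp

lemma analytic_P: "h \<in> {0<..<1/6} \<Longrightarrow> analytic_at_real (P a b c) h"
  unfolding P_def [abs_def] by (intro analytic_at_real_intros analytic)

lemma analytic_D: "h \<in> {0<..<1/6} \<Longrightarrow> analytic_at_real D h"
  unfolding D_def [abs_def] using pos(2)[of h]
  by (intro analytic_at_real_intros analytic) auto

lemma analytic_g: "h \<in> {0<..<1/6} \<Longrightarrow> analytic_at_real (g a b c) h"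
  unfolding g_def [abs_def] by (intro analytic_at_real_intros analytic_D) auto

text \<open>No zero is lost, because \<open>F / sqrt (1 - 6 h)\<close> vanishes at the centre.\<close>
lemma zeros_combination_le_zeros_P:
  assumes "at_most_zeros_on n (P a b c) {0<..<1/6}"
  shows "at_most_zeros_on n (\<lambda>h. a * X h + b * Y h + c * Z h) {0<..<1/6}"
proof -
  define F where "F = (\<lambda>h. a * X h + b * Y h + c * Z h)"
  define u where "u = (\<lambda>h. P a b c h * (1 / ((1 - 6 * h) * sqrt (1 - 6 * h))))"
  have an: "analytic_at_real (\<lambda>h. 1 / ((1 - 6 * h) * sqrt (1 - 6 * h))) h" if "h \<in> {0<..<1/6}" for h
    using that by (intro analytic_at_real_intros analytic_sqrt) auto
  have anF: "analytic_at_real F h" if "h \<in> {0<..<1/6}" for h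
    unfolding F_def using that by (intro analytic_at_real_intros analytic)
  have "at_most_zeros_on n u {0<..<1/6}"
    using assms at_most_zeros_on_mult[of "{0<..<1/6}" "P a b c" _ u n, OF _ analytic_P an]
    by (simp add: u_def)
  then have "at_most_zeros_on n (\<lambda>h. F h * (1 / sqrt (1 - 6 * h))) {0<..<1/6}"
  proof (rule at_most_zeros_on_Rolle_left_end[rotated 2])
    fix h :: real assume h: "h \<in> {0<..<1/6}"
    show "analytic_at_real u h"
      unfolding u_def using h by (intro analytic_at_real_mult analytic_P an)
    define q where "q = sqrt (1 - 6 * h)"
    have q: "q > 0" "1 - 6 * h = q * q" using h by (auto simp: q_def)
    define F' where "F' = a * ((3 * X h + Y h + K h) / (1 - 6 * h)) + b * (K h / (1 - 6 * h)) + c * ((K h - 3 * Z h) / (1 - 6 * h))"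
    have "(F has_real_derivative F') (at h)"
      unfolding F_def F'_def
      by (rule derivative_eq_intros X_deriv Y_deriv Z_deriv h refl)+ (simp add: algebra_simps)
    from DERIV_divide[OF this sqrt_deriv[OF h]]
    have "((\<lambda>h. F h / sqrt (1 - 6 * h)) has_real_derivative (F' * q - F h * (- 3 / q)) / (q * q)) (at h)"
      using q(1) by (simp add: q_def)
    moreover have "(F' * q - F h * (- 3 / q)) / (q * q) = u h"
      unfolding u_def P_def F'_def F_def q_def[symmetric] q(2) using q(1)
      by (simp add: divide_simps) algebra
    ultimately show "((\<lambda>h. F h * (1 / sqrt (1 - 6 * h))) has_real_derivative u h) (at h)"
      by simp
  next
    have "((\<lambda>h. F h * (1 / sqrt (1 - 6 * h))) \<longlongrightarrow> (a * 0 + b * 0 + c * 0) * (1 / sqrt (1 - 6 * 0))) (at_right 0)"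
      unfolding F_def by (intro tendsto_intros lim0) auto
    then show "((\<lambda>h. F h * (1 / sqrt (1 - 6 * h))) \<longlongrightarrow> 0) (at_right 0)" by simp
  qed
  moreover have "analytic_at_real (\<lambda>h. 1 / sqrt (1 - 6 * h)) h" if "h \<in> {0<..<1/6}" for h
    using that by (intro analytic_at_real_intros analytic_sqrt) auto
  ultimately show ?thesis
    using at_most_zeros_on_mult[of "{0<..<1/6}" F "\<lambda>h. 1 / sqrt (1 - 6 * h)", OF _ anF]
    by (simp add: F_def)
qed

lemma sqrt_P_deriv:
  assumes h: "h \<in> {0<..<1/6}"
  shows "((\<lambda>h. P a b c h * sqrt (1 - 6 * h)) has_real_derivative g a b c h * (Y h / sqrt (1 - 6 * h))) (at h)"
proof -
  define q where "q = sqrt (1 - 6 * h)"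
  have q: "q > 0" "1 - 6 * h = q * q" using h by (auto simp: q_def)
  define P' where "P' = a * (6 * ((3 * X h + Y h + K h) / (1 - 6 * h)) + (- Y h / (6 * h)) + K h / (1 - 6 * h))
      + b * ((- Y h / (6 * h)) + 3 * (K h / (1 - 6 * h))) + c * (- Y h / (6 * h))"
  have "(P a b c has_real_derivative P') (at h)"
    unfolding P_def [abs_def] P'_def
    by (rule derivative_eq_intros X_deriv Y_deriv K_deriv h refl)+ (simp add: algebra_simps)
  from DERIV_mult[OF this sqrt_deriv[OF h]]
  have "((\<lambda>h. P a b c h * sqrt (1 - 6 * h)) has_real_derivative P' * q + - 3 / q * P a b c h) (at h)"
    by (simp add: q_def)
  also have "P' * q + - 3 / q * P a b c h = g a b c h * (Y h / q)"
    unfolding P'_def P_def g_def K_eq[OF h] q(2) using q(1) h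
    by (simp add: divide_simps) algebra
  finally show ?thesis by (simp add: q_def)
qed

lemma zeros_P_le_Suc_zeros_g:
  assumes g: "at_most_zeros_on n (g a b c) {0<..<e}" and e: "e \<le> 1/6"
  shows "at_most_zeros_on (Suc n) (P a b c) {0<..<e}"
proof -
  have an: "analytic_at_real (\<lambda>h. Y h / sqrt (1 - 6 * h)) h" if "h \<in> {0<..<e}" for h
    using that e by (intro analytic_at_real_intros analytic analytic_sqrt) auto
  have ang: "analytic_at_real (g a b c) h" and anP: "analytic_at_real (P a b c) h"
      and ans: "analytic_at_real (\<lambda>h. sqrt (1 - 6 * h)) h" if "h \<in> {0<..<e}" for h
    using that e by (auto intro: analytic_g analytic_P analytic_sqrt)
  have nz: "Y h / sqrt (1 - 6 * h) \<noteq> 0" "sqrt (1 - 6 * h) \<noteq> 0" if "h \<in> {0<..<e}" for h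
    using that e pos(2)[of h] by auto
  have "at_most_zeros_on n (\<lambda>h. g a b c h * (Y h / sqrt (1 - 6 * h))) {0<..<e}"
    using g at_most_zeros_on_mult[OF open_greaterThanLessThan ang an nz(1) refl] by blast
  then have "at_most_zeros_on (Suc n) (\<lambda>h. P a b c h * sqrt (1 - 6 * h)) {0<..<e}"
    by (rule at_most_zeros_on_Rolle[rotated 2])
       (use e in \<open>auto intro!: sqrt_P_deriv analytic_at_real_mult ang an simp del: times_divide_eq_right\<close>)
  then show ?thesis
    using at_most_zeros_on_mult[OF open_greaterThanLessThan anP ans nz(2) refl] by blast
qed

lemma g_deriv:
  assumes h: "h \<in> {0<..<1/6}"
  shows "(g a b c has_real_derivative - ((23 * a - b - 19 * c) + (4 * a - 3 * c) * s h) / (6 * h\<^sup>2)) (at h)"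
proof -
  have "((\<lambda>h. (1 - 6 * h) / (6 * h)) has_real_derivative - 1 / (6 * h\<^sup>2)) (at h)"
    using h by (auto intro!: derivative_eq_intros simp: divide_simps power2_eq_square)
  from DERIV_add[OF DERIV_add[OF DERIV_const DERIV_cmult[OF this]] DERIV_cmult[OF D_deriv[OF h]]]
  have "(g a b c has_real_derivative 0 + (23 * a - b - 19 * c) * (- 1 / (6 * h\<^sup>2))
      + (4 * a - 3 * c) * (- s h / (6 * h\<^sup>2))) (at h)"
    unfolding g_def [abs_def] .
  then show ?thesis by (simp add: diff_divide_distrib add_divide_distrib)
qed

lemma g_zeros_le_1:
  assumes e: "e \<le> 1/6" and ne: "\<And>h. h \<in> {0<..<e} \<Longrightarrow> (23 * a - b - 19 * c) + (4 * a - 3 * c) * s h \<noteq> 0"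
  shows "at_most_zeros_on 1 (g a b c) {0<..<e}"
proof -
  define v where "v = (\<lambda>h. (23 * a - b - 19 * c) + (4 * a - 3 * c) * s h)"
  let ?u = "\<lambda>h. - v h / (6 * h\<^sup>2)"
  have v: "v h \<noteq> 0" if "h \<in> {0<..<e}" for h
    unfolding v_def using ne[OF that] .
  have d: "(g a b c has_real_derivative ?u h) (at h)" if "h \<in> {0<..<e}" for h
    using g_deriv[of h a b c] that e by (auto simp: v_def)
  have "analytic_at_real ?u h" if "h \<in> {0<..<e}" for h
  proof (rule analytic_at_real_cong_open[of "{0<..<e}" h "deriv (g a b c)"])
    show "analytic_at_real (deriv (g a b c)) h"
      using that e by (intro analytic_at_real_deriv analytic_g) auto
  qed (use that d DERIV_imp_deriv in auto)
  moreover have "at_most_zeros_on 0 ?u {0<..<e}"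
    using v by (intro at_most_zeros_on_0) auto
  ultimately show ?thesis
    using at_most_zeros_on_Rolle[of 0 e "g a b c" ?u 0] d by simp
qed

text \<open>On the last interval where \<open>g\<close> is positive, \<open>sqrt (1 - 6 h) P\<close> increases. It stays below a function tending to \<open>0\<close> at the
  saddle loop, since the terms with \<open>Y\<close> and \<open>K\<close> vanish there in the limit and the others carry the negative factor \<open>a\<close>.\<close>
lemma P_neg_near_right_end:
  assumes a: "a < 0" and e: "0 < e" and gpos: "\<And>h. h \<in> {e<..<1/6} \<Longrightarrow> g a b c h > 0"
    and h: "e \<le> h" "h < 1/6"
  shows "P a b c h < 0"
proof -
  let ?p = "\<lambda>h. P a b c h * sqrt (1 - 6 * h)"
  have mono: "?p y < ?p z" if "e \<le> y" "y < z" "z < 1/6" for y z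
  proof (rule DERIV_pos_imp_increasing_open[OF \<open>y < z\<close>])
    fix x assume "y < x" "x < z"
    then have x: "x \<in> {0<..<1/6}" "x \<in> {e<..<1/6}" using that e by auto
    show "\<exists>d. (?p has_real_derivative d) (at x) \<and> d > 0"
      using sqrt_P_deriv[OF x(1), of a b c] gpos[OF x(2)] pos(2)[OF x(1)] x(1)
      by (intro exI[of _ "g a b c x * (Y x / sqrt (1 - 6 * x))"]) auto
  next
    show "continuous_on {y..z} ?p"
    proof (rule DERIV_atLeastAtMost_imp_continuous_on)
      fix x assume "y \<le> x" "x \<le> z"
      then have "x \<in> {0<..<1/6}" using that e by auto
      then show "\<exists>d. (?p has_real_derivative d) (at x)" using sqrt_P_deriv by blast
    qed
  qed
  define h' where "h' = (h + 1/6) / 2"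
  have h': "h < h'" "h' < 1/6" using h by (auto simp: h'_def)
  let ?q = "\<lambda>y. 3 * b * (sqrt (1 - 6 * y) * Y y) + (b + c) * (sqrt (1 - 6 * y) * K y)"
  have "(?q \<longlongrightarrow> 3 * b * 0 + (b + c) * 0) (at_left (1/6))"
    by (intro tendsto_intros Y_sqrt_tendsto_0 K_sqrt_tendsto_0)
  moreover have "eventually (\<lambda>y. ?p h' \<le> ?q y) (at_left (1/6))"
    using eventually_at_left_real[OF h'(2)]
  proof eventually_elim
    case (elim y)
    then have y: "y \<in> {0<..<1/6}" using h e h' by auto
    have "?p h' \<le> ?p y" using mono[of h' y] elim h h' by auto
    also have "\<dots> \<le> ?q y"
    proof -
      have "a * (6 * X y + K y + Y y) \<le> 0"
        using a pos[OF y] by (intro mult_nonpos_nonneg) auto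
      then have "P a b c y \<le> 3 * b * Y y + (b + c) * K y"
        unfolding P_def by (simp add: algebra_simps)
      then have "?p y \<le> (3 * b * Y y + (b + c) * K y) * sqrt (1 - 6 * y)"
        using y by (intro mult_right_mono) auto
      then show ?thesis by (simp add: algebra_simps)
    qed
    finally show ?case .
  qed
  ultimately have "?p h' \<le> 0"
    using tendsto_lowerbound[of ?q 0] by auto
  then have "?p h < 0" using mono[of h h'] h h' by auto
  then show ?thesis using h by (simp add: mult_less_0_iff)
qed

text \<open>Here \<open>g\<close> decreases, possibly only up to some level after which it increases, and may then have two zeros.
  After the second one, \<open>P\<close> is negative up to the saddle loop, so only the first zero of \<open>g\<close> counts for the zeros of \<open>P\<close>.\<close>
lemma zeros_P_le_2_oscillating:
  assumes a: "a < 0" and B: "23 * a - b - 19 * c > 0" and d: "4 * a - 3 * c < 0"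
  shows "at_most_zeros_on 2 (P a b c) {0<..<1/6}"
proof -
  define v where "v = (\<lambda>h. (23 * a - b - 19 * c) + (4 * a - 3 * c) * s h)"
  have v_mono: "v y < v x" if "x \<in> {0<..<1/6}" "y \<in> {0<..<1/6}" "x < y" for x y
    using s_strict_mono[OF that] d unfolding v_def by (simp add: mult_less_cancel_left)
  have gd: "(g a b c has_real_derivative - v h / (6 * h\<^sup>2)) (at h)" if "h \<in> {0<..<1/6}" for h
    using g_deriv[OF that, of a b c] by (simp add: v_def)
  show ?thesis
  proof (cases "\<exists>k\<in>{0<..<1/6}. v k = 0")
    case False
    then have "at_most_zeros_on 1 (g a b c) {0<..<1/6}"
      by (intro g_zeros_le_1) (auto simp: v_def)
    from zeros_P_le_Suc_zeros_g[OF this] show ?thesis by (simp add: numeral_2_eq_2)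
  next
    case True
    then obtain k where k: "k \<in> {0<..<1/6}" "v k = 0" by blast
    have left: "at_most_zeros_on 1 (g a b c) {0<..<k}"
      using k v_mono[of _ k] by (intro g_zeros_le_1) (force simp: v_def)+
    have incr: "g a b c y < g a b c z" if "k \<le> y" "y < z" "z < 1/6" for y z
    proof (rule DERIV_pos_imp_increasing_open[OF \<open>y < z\<close>])
      fix x assume "y < x" "x < z"
      then have x: "x \<in> {0<..<1/6}" "k < x" using that k by auto
      then have "v x < 0" using v_mono[OF k(1) x(1)] k by simp
      then have "- v x / (6 * x\<^sup>2) > 0" using x by (intro divide_pos_pos) auto
      then show "\<exists>d. (g a b c has_real_derivative d) (at x) \<and> d > 0" using gd[OF x(1)] by blast
    next
      show "continuous_on {y..z} (g a b c)"
      proof (rule DERIV_atLeastAtMost_imp_continuous_on)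
        fix x assume "y \<le> x" "x \<le> z"
        then have "x \<in> {0<..<1/6}" using that k by auto
        then show "\<exists>d. (g a b c has_real_derivative d) (at x)" using gd by blast
      qed
    qed
    have decr: "g a b c k < g a b c y" if "0 < y" "y < k" for y
    proof (rule DERIV_neg_imp_decreasing_open[OF \<open>y < k\<close>])
      fix x assume "y < x" "x < k"
      then have x: "x \<in> {0<..<1/6}" "x < k" using that k by auto
      then have "v x > 0" using v_mono[OF x(1) k(1)] k by simp
      then have "- v x / (6 * x\<^sup>2) < 0" using x by (intro divide_neg_pos) auto
      then show "\<exists>d. (g a b c has_real_derivative d) (at x) \<and> d < 0" using gd[OF x(1)] by blast
    next
      show "continuous_on {y..k} (g a b c)"
      proof (rule DERIV_atLeastAtMost_imp_continuous_on)
        fix x assume "y \<le> x" "x \<le> k"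
        then have "x \<in> {0<..<1/6}" using that k by auto
        then show "\<exists>d. (g a b c has_real_derivative d) (at x)" using gd by blast
      qed
    qed
    consider "g a b c k \<ge> 0" | "g a b c k < 0" "\<And>h. h \<in> {k<..<1/6} \<Longrightarrow> g a b c h < 0"
      | y where "g a b c k < 0" "y \<in> {k<..<1/6}" "g a b c y \<ge> 0"
      by force
    then show ?thesis
    proof cases
      case 1
      have "P a b c h < 0" if h: "h \<in> {0<..<1/6}" for h
      proof -
        have nonneg: "g a b c x > 0" if "x \<in> {0<..<1/6}" "x \<noteq> k" for x
          using 1 decr[of x] incr[of k x] that by (cases "x < k") auto
        show ?thesis
        proof (cases "h < k")
          case False
          then show ?thesis
            using P_neg_near_right_end[OF a, of k b c h] nonneg k h by auto
        next
          case True
          have "P a b c k * sqrt (1 - 6 * k) < 0"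
            using P_neg_near_right_end[OF a, of k b c k] nonneg k by (auto simp: mult_less_0_iff)
          moreover have "P a b c h * sqrt (1 - 6 * h) < P a b c k * sqrt (1 - 6 * k)"
          proof (rule DERIV_pos_imp_increasing_open[OF True])
            fix x assume "h < x" "x < k"
            then have x: "x \<in> {0<..<1/6}" "x \<noteq> k" using k h by auto
            show "\<exists>d. ((\<lambda>h. P a b c h * sqrt (1 - 6 * h)) has_real_derivative d) (at x) \<and> d > 0"
              using sqrt_P_deriv[OF x(1), of a b c] nonneg[OF x] pos(2)[OF x(1)] x(1)
              by (intro exI[of _ "g a b c x * (Y x / sqrt (1 - 6 * x))"]) auto
          next
            show "continuous_on {h..k} (\<lambda>h. P a b c h * sqrt (1 - 6 * h))"
            proof (rule DERIV_atLeastAtMost_imp_continuous_on)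
              fix x assume "h \<le> x" "x \<le> k"
              then have "x \<in> {0<..<1/6}" using h k by auto
              then show "\<exists>d. ((\<lambda>h. P a b c h * sqrt (1 - 6 * h)) has_real_derivative d) (at x)"
                using sqrt_P_deriv by blast
            qed
          qed
          ultimately have "P a b c h * sqrt (1 - 6 * h) < 0" by simp
          then show ?thesis using h by (simp add: mult_less_0_iff)
        qed
      qed
      then have "at_most_zeros_on 0 (P a b c) {0<..<1/6}"
        by (intro at_most_zeros_on_0) force
      then show ?thesis by (rule at_most_zeros_on_mono) simp
    next
      case 2
      have "at_most_zeros_on 1 (g a b c) {0<..<1/6}"
      proof (rule at_most_zeros_on_restrict[OF left])
        fix x assume "x \<in> {0<..<1/6} - {0<..<k}"
        then have "x = k \<or> x \<in> {k<..<1/6}" by auto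
        then show "g a b c x \<noteq> 0" using 2 by force
      qed (use k in auto)
      from zeros_P_le_Suc_zeros_g[OF this] show ?thesis by (simp add: numeral_2_eq_2)
    next
      case 3
      have "continuous_on {k..y} (g a b c)"
      proof (rule DERIV_atLeastAtMost_imp_continuous_on)
        fix x assume "k \<le> x" "x \<le> y"
        then have "x \<in> {0<..<1/6}" using 3 k by auto
        then show "\<exists>d. (g a b c has_real_derivative d) (at x)" using gd by blast
      qed
      then obtain e where e: "k \<le> e" "e \<le> y" "g a b c e = 0"
        using IVT'[of "g a b c" k 0 y] 3 by auto
      have e': "e < 1/6" "k < e" using e 3 by (auto simp: order_less_le)
      have neg: "P a b c h < 0" if "e \<le> h" "h < 1/6" for h
      proof (rule P_neg_near_right_end[OF a _ _ that])
        show "0 < e" using e' k by auto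
        show "g a b c x > 0" if "x \<in> {e<..<1/6}" for x
          using incr[of e x] that e by auto
      qed
      have "at_most_zeros_on 1 (g a b c) {0<..<e}"
      proof (rule at_most_zeros_on_restrict[OF left])
        fix x assume "x \<in> {0<..<e} - {0<..<k}"
        then have "k \<le> x" "x < e" by auto
        then show "g a b c x \<noteq> 0" using incr[of x e] e e' by auto
      qed (use e in auto)
      then have "at_most_zeros_on 2 (P a b c) {0<..<e}"
        using zeros_P_le_Suc_zeros_g[of 1] e' by (simp add: numeral_2_eq_2)
      then show ?thesis
      proof (rule at_most_zeros_on_restrict)
        fix x assume "x \<in> {0<..<1/6} - {0<..<e}"
        then show "P a b c x \<noteq> 0" using neg[of x] by auto
      qed (use e' in auto)
    qed
  qed
qed

text \<open>Let \<open>m = (1 - 6 h) / (6 h)\<close>. If the coefficients \<open>B\<close> and \<open>d\<close> of \<open>m\<close> and \<open>D\<close> in \<open>g\<close> do not have opposite signs, \<open>g\<close> is monotone. If they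
  do, the form \<open>24 a + B (9 + m) - d (57 - D)\<close> of \<open>g\<close> shows that \<open>g\<close> keeps its sign, except when \<open>a\<close> and \<open>B\<close> have
  opposite signs; this is the oscillating case, up to the sign of the triple.\<close>
lemma zeros_P_le_2:
  assumes a: "a \<noteq> 0"
  shows "at_most_zeros_on 2 (P a b c) {0<..<1/6}"
proof -
  define B d where "B = 23 * a - b - 19 * c" and "d = 4 * a - 3 * c"
  have flip: "at_most_zeros_on n (P a b c) L \<longleftrightarrow> at_most_zeros_on n (P (- a) (- b) (- c)) L"
    if "L = {0<..<1/6}" for n L
    using that by (intro at_most_zeros_on_mult[where g = "\<lambda>_. - 1"])
      (auto intro: analytic_P analytic_at_real_const simp: P_def algebra_simps)
  have g_alt: "g a b c h = 24 * a + B * (9 + (1 - 6 * h) / (6 * h)) - d * (57 - D h)" for h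
    by (simp add: g_def B_def d_def algebra_simps)
  have *: "at_most_zeros_on 2 (P a b c) {0<..<1/6}" if "at_most_zeros_on 1 (g a b c) {0<..<1/6}"
    using zeros_P_le_Suc_zeros_g[OF that] by (simp add: numeral_2_eq_2)
  have no_zero: ?thesis if "\<And>h. h \<in> {0<..<1/6} \<Longrightarrow> g a b c h \<noteq> 0"
    using at_most_zeros_on_mono[OF at_most_zeros_on_0[of "{0<..<1/6}" "g a b c"], of 1] that * by simp
  have tpos: "9 + (1 - 6 * h) / (6 * h) > 0" "57 - D h > 0" if "h \<in> {0<..<1/6}" for h
  proof -
    have "(1 - 6 * h) / (6 * h) \<ge> 0" using that by (intro divide_nonneg_nonneg) auto
    then show "9 + (1 - 6 * h) / (6 * h) > 0" by linarith
    show "57 - D h > 0" using D_upper[OF that] by simp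
  qed
  consider "B = 0" "d = 0" | "B \<ge> 0" "d \<ge> 0" "B \<noteq> 0 \<or> d \<noteq> 0" | "B \<le> 0" "d \<le> 0" "B \<noteq> 0 \<or> d \<noteq> 0"
    | "B > 0" "d < 0" | "B < 0" "d > 0" by linarith
  then show ?thesis
  proof cases
    case 1
    then show ?thesis using no_zero a by (auto simp: g_alt)
  next
    case 2
    have "B + d * s h \<noteq> 0" if "h \<in> {0<..<1/6}" for h
      using 2 s_pos[OF that] by (smt (verit) mult_nonneg_nonneg mult_pos_pos)
    then show ?thesis by (intro * g_zeros_le_1) (auto simp: B_def d_def)
  next
    case 3
    have "B + d * s h \<noteq> 0" if "h \<in> {0<..<1/6}" for h
      using 3 s_pos[OF that] by (smt (verit) mult_nonpos_nonneg mult_neg_pos)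
    then show ?thesis by (intro * g_zeros_le_1) (auto simp: B_def d_def)
  next
    case 4
    show ?thesis
    proof (cases "a < 0")
      case True
      then show ?thesis using zeros_P_le_2_oscillating 4 by (simp add: B_def d_def)
    next
      case False
      have "g a b c h > 0" if "h \<in> {0<..<1/6}" for h
      proof -
        have "B * (9 + (1 - 6 * h) / (6 * h)) > 0" "d * (57 - D h) < 0"
          using 4 tpos[OF that] by (auto intro: mult_pos_pos mult_neg_pos)
        then show ?thesis using False g_alt[of h] by linarith
      qed
      then show ?thesis using no_zero by force
    qed
  next
    case 5
    show ?thesis
    proof (cases "a > 0")
      case True
      then show ?thesis
        using zeros_P_le_2_oscillating[of "- a" "- b" "- c"] 5 flip[OF refl] by (simp add: B_def d_def)
    next
      case False
      have "g a b c h < 0" if "h \<in> {0<..<1/6}" for h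
      proof -
        have "B * (9 + (1 - 6 * h) / (6 * h)) < 0" "d * (57 - D h) > 0"
          using 5 tpos[OF that] by (auto intro: mult_pos_pos mult_neg_pos)
        then show ?thesis using False g_alt[of h] by linarith
      qed
      then show ?thesis using no_zero by force
    qed
  qed
qed

lemma zeros_P_le_1:
  assumes "b \<noteq> 0 \<or> c \<noteq> 0"
  shows "at_most_zeros_on 1 (P 0 b c) {0<..<1/6}"
proof -
  define w where "w = (\<lambda>h. 3 * b + (b + c) * (K h / Y h))"
  define u where "u = (\<lambda>h. (b + c) * ((- Y h / (6 * h) * Y h - K h * (K h / (1 - 6 * h))) / (Y h * Y h)))"
  have an: "analytic_at_real w h" if "h \<in> {0<..<1/6}" for h
    unfolding w_def using that pos(2)[OF that] by (intro analytic_at_real_intros analytic) auto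
  have wd: "(w has_real_derivative u h) (at h)" if "h \<in> {0<..<1/6}" for h
  proof -
    have "Y h \<noteq> 0" using pos(2)[OF that] by simp
    from DERIV_add[OF DERIV_const DERIV_cmult[OF DERIV_divide[OF K_deriv Y_deriv this, OF that that]]]
    show ?thesis unfolding w_def u_def by simp
  qed
  have "at_most_zeros_on 1 w {0<..<1/6}"
  proof (cases "b + c = 0")
    case True
    then have "at_most_zeros_on 0 w {0<..<1/6}"
      using assms by (intro at_most_zeros_on_0) (auto simp: w_def)
    then show ?thesis by (rule at_most_zeros_on_mono) simp
  next
    case False
    have u: "u h \<noteq> 0" if h: "h \<in> {0<..<1/6}" for h
    proof -
      have "- Y h / (6 * h) * Y h < 0"
        using pos(2)[OF h] h by (intro mult_neg_pos divide_neg_pos) auto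
      moreover have "K h * (K h / (1 - 6 * h)) > 0"
        using pos(3)[OF h] h by simp
      ultimately have "- Y h / (6 * h) * Y h - K h * (K h / (1 - 6 * h)) < 0" by linarith
      then show ?thesis using False pos(2)[OF h] unfolding u_def by simp
    qed
    have anu: "analytic_at_real u h" if "h \<in> {0<..<1/6}" for h
    proof (rule analytic_at_real_cong_open[of "{0<..<1/6}" h "deriv w"])
      show "analytic_at_real (deriv w) h" by (intro analytic_at_real_deriv an that)
    qed (use that wd DERIV_imp_deriv in auto)
    show ?thesis
      using at_most_zeros_on_Rolle[OF wd anu at_most_zeros_on_0[OF u]] by simp
  qed
  moreover have "P 0 b c h = w h * Y h" if "h \<in> {0<..<1/6}" for h
    using pos(2)[OF that] by (simp add: P_def w_def field_simps)
  ultimately show ?thesis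
    using at_most_zeros_on_mult[OF open_greaterThanLessThan an analytic(2), of 0 "1/6" "P 0 b c"] pos(2) by force
qed

lemma combination_YZ_zeros:
  assumes "b \<noteq> 0 \<or> c \<noteq> 0"
  shows "at_most_zeros_on 1 (\<lambda>h. b * Y h + c * Z h) {0<..<1/6}"
  using zeros_combination_le_zeros_P[OF zeros_P_le_1[OF assms]] by simp

lemma combination_XYZ_zeros:
  assumes "a \<noteq> 0 \<or> b \<noteq> 0 \<or> c \<noteq> 0"
  shows "at_most_zeros_on 2 (\<lambda>h. a * X h + b * Y h + c * Z h) {0<..<1/6}"
proof (cases "a = 0")
  case True
  then show ?thesis using combination_YZ_zeros[of b c] assms at_most_zeros_on_mono[of 1 _ _ 2] by simp
next
  case False
  then show ?thesis by (intro zeros_combination_le_zeros_P zeros_P_le_2)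
qed

end

section \<open>The angular form of the Abelian integrals\<close>

text \<open>The value of \<open>x + 1\<close> at the point of an oval with \<open>W = sqrt (6 h) cos t\<close>: the inverse, on the period annulus,
  of the signed square root \<open>W\<close> of \<open>(2 x + 3) x\<^sup>2\<close>. The trisection formula for the cosine makes it explicit.\<close>
definition u_oval :: "real \<Rightarrow> real" where
  "u_oval W = 1 / 2 + cos (2 / 3 * arccos W)"

definition u_oval' :: "real \<Rightarrow> real" where
  "u_oval' W = 2 / 3 * sin (2 / 3 * arccos W) / sqrt (1 - W\<^sup>2)"

lemma u_oval_deriv:
  assumes "\<bar>W\<bar> < 1"
  shows "(u_oval has_real_derivative u_oval' W) (at W)"
proof -
  have W: "- 1 < W" "W < 1" using assms by auto
  then have "W\<^sup>2 < 1" using assms by (simp add: abs_square_less_1)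
  have "(u_oval has_real_derivative - sin (2 / 3 * arccos W) * (2 / 3 * inverse (- sqrt (1 - W\<^sup>2)))) (at W)"
    unfolding u_oval_def [abs_def]
    using W by (auto intro!: derivative_eq_intros)
  then show ?thesis
    using \<open>W\<^sup>2 < 1\<close> by (simp add: u_oval'_def field_simps)
qed

lemma arccos_bounds_open:
  assumes "\<bar>W\<bar> < 1"
  shows "0 < arccos W" "arccos W < pi"
  using arccos_lt_bounded[of W] assms by auto

lemma u_oval_pos:
  assumes "\<bar>W\<bar> < 1"
  shows "u_oval W > 0"
proof -
  have "cos (2 / 3 * arccos W) > cos (2 / 3 * pi)"
    using arccos_bounds_open[OF assms] by (intro cos_monotone_0_pi) auto
  also have "cos (2 / 3 * pi) = - 1 / 2"
    using cos_120 by (simp add: mult.commute)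
  finally show ?thesis by (simp add: u_oval_def)
qed

lemma u_oval'_pos:
  assumes "\<bar>W\<bar> < 1"
  shows "u_oval' W > 0"
proof -
  have "sin (2 / 3 * arccos W) > 0"
    using arccos_bounds_open[OF assms] by (intro sin_gt_zero) auto
  moreover have "W\<^sup>2 < 1" using assms by (simp add: abs_square_less_1)
  ultimately show ?thesis by (simp add: u_oval'_def)
qed

lemma u_oval_cubic:
  assumes "\<bar>W\<bar> \<le> 1"
  shows "2 * u_oval W ^ 3 - 3 * u_oval W ^ 2 + 1 = W\<^sup>2"
proof -
  define c where "c = cos (2 / 3 * arccos W)"
  have "W = cos (arccos W)" using assms by simp
  then have "2 * W\<^sup>2 - 1 = cos (2 * arccos W)" by (metis cos_double_cos)
  also have "2 * arccos W = 3 * (2 / 3 * arccos W)" by simp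
  also have "cos \<dots> = 4 * c ^ 3 - 3 * c" unfolding c_def by (rule cos_treble_cos)
  finally have "2 * W\<^sup>2 - 1 = 4 * c ^ 3 - 3 * c" .
  moreover have "2 * (1 / 2 + c) ^ 3 - 3 * (1 / 2 + c)\<^sup>2 + 1 = (4 * c ^ 3 - 3 * c + 1) / 2"
    by (simp add: power2_eq_square power3_eq_cube field_simps)
  ultimately show ?thesis unfolding u_oval_def c_def[symmetric] by simp
qed

lemma u_oval'_relation:
  assumes "\<bar>W\<bar> < 1"
  shows "3 * ((u_oval W)\<^sup>2 - u_oval W) * u_oval' W = W"
proof -
  have d: "((\<lambda>W. 2 * u_oval W ^ 3 - 3 * u_oval W ^ 2 + 1) has_real_derivative
      6 * ((u_oval W)\<^sup>2 - u_oval W) * u_oval' W) (at W)"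
    by (rule derivative_eq_intros u_oval_deriv assms refl)+ (simp add: power2_eq_square algebra_simps)
  have "eventually (\<lambda>W. W \<in> {-1<..<1}) (nhds W)"
    using assms by (intro eventually_nhds_in_open) auto
  then have ev: "eventually (\<lambda>W. 2 * u_oval W ^ 3 - 3 * u_oval W ^ 2 + 1 = W\<^sup>2) (nhds W)"
    by eventually_elim (intro u_oval_cubic, auto)
  have "((\<lambda>W. W\<^sup>2) has_real_derivative 6 * ((u_oval W)\<^sup>2 - u_oval W) * u_oval' W) (at W)"
    using d unfolding DERIV_cong_ev[OF refl ev refl] .
  moreover have "((\<lambda>W. W\<^sup>2) has_real_derivative 2 * W) (at W)"
    by (auto intro!: derivative_eq_intros)
  ultimately have "6 * ((u_oval W)\<^sup>2 - u_oval W) * u_oval' W = 2 * W"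
    by (rule DERIV_unique)
  then show ?thesis by (simp only: mult.assoc)
qed

definition u_complex :: "complex \<Rightarrow> complex" where
  "u_complex w = 1 / 2 + cos (2 / 3 * Arccos w)"

lemma u_complex_holomorphic: "u_complex holomorphic_on ball 0 1"
proof -
  have "\<bar>Re w\<bar> < 1" if "w \<in> ball 0 1" for w
    using that abs_Re_le_cmod[of w] by simp
  then show ?thesis
    unfolding u_complex_def [abs_def]
    by (intro holomorphic_intros holomorphic_on_Arccos) auto
qed

lemma u_complex_of_real: "\<bar>W\<bar> \<le> 1 \<Longrightarrow> u_complex (of_real W) = of_real (u_oval W)"
  by (simp add: u_complex_def u_oval_def flip: of_real_arccos cos_of_real)

text \<open>A zero would have \<open>cos (2/3 Arccos w) = -1/2\<close>, and the triple angle formula then forces \<open>w\<^sup>2 = 1\<close>. This keeps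
  the negative powers of \<open>x + 1\<close> holomorphic on the whole unit disc.\<close>
lemma u_complex_nonzero:
  assumes "w \<in> ball 0 1"
  shows "u_complex w \<noteq> 0"
proof
  assume "u_complex w = 0"
  define c where "c = cos (2 / 3 * Arccos w)"
  have c: "c = - 1 / 2"
    using \<open>u_complex w = 0\<close> unfolding u_complex_def c_def by (simp add: add_eq_0_iff)
  have "2 * w\<^sup>2 - 1 = cos (2 * Arccos w)"
    by (simp add: cos_double_cos)
  also have "2 * Arccos w = 3 * (2 / 3 * Arccos w)" by simp
  also have "cos \<dots> = 4 * c ^ 3 - 3 * c" unfolding c_def by (rule cos_treble_cos)
  also have "\<dots> = 1" by (simp add: c power3_eq_cube)
  finally have "w\<^sup>2 = 1" by simp
  then have "norm w = 1" by (metis norm_one norm_power power2_eq_1_iff norm_minus_cancel)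
  then show False using assms by simp
qed

definition oval_weight :: "int \<Rightarrow> real \<Rightarrow> real" where
  "oval_weight k W = u_oval W powi k * u_oval' W"

definition oval_weight_complex :: "int \<Rightarrow> complex \<Rightarrow> complex" where
  "oval_weight_complex k w = u_complex w powi k * deriv u_complex w"

lemma oval_weight_complex_holomorphic: "oval_weight_complex k holomorphic_on ball 0 1"
  unfolding oval_weight_complex_def [abs_def]
  by (intro holomorphic_intros u_complex_holomorphic) (use u_complex_nonzero in auto)

lemma oval_weight_complex_of_real:
  assumes "\<bar>W\<bar> < 1"
  shows "oval_weight_complex k (of_real W) = of_real (oval_weight k W)"
proof -
  have an: "u_complex analytic_on {complex_of_real W}"
    using assms by (intro holomorphic_on_imp_analytic_at[OF u_complex_holomorphic]) auto
  have "eventually (\<lambda>W. W \<in> {-1<..<1}) (nhds W)"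
    using assms by (intro eventually_nhds_in_open) auto
  then have ev: "eventually (\<lambda>W. u_complex (of_real W) = of_real (u_oval W)) (nhds W)"
    by eventually_elim (intro u_complex_of_real, auto)
  have "deriv u_complex (of_real W) = of_real (u_oval' W)"
    using extension_derivative(2)[OF an ev] DERIV_imp_deriv[OF u_oval_deriv[OF assms]] by simp
  then show ?thesis
    using assms by (simp add: oval_weight_complex_def oval_weight_def u_complex_of_real of_real_power_int)
qed

lemma continuous_oval_weight: "continuous_on {-1<..<1} (oval_weight k)"
proof -
  have "continuous_on {-1<..<1} (\<lambda>W. Re (oval_weight_complex k (complex_of_real W)))"
    by (intro continuous_intros continuous_on_compose2[OF holomorphic_on_imp_continuous_on[OF oval_weight_complex_holomorphic]])
       auto
  then show ?thesis
    by (rule continuous_on_eq) (subst oval_weight_complex_of_real, auto)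
qed

lemma oval_weight_pos: "\<bar>W\<bar> < 1 \<Longrightarrow> oval_weight k W > 0"
  by (simp add: oval_weight_def u_oval_pos u_oval'_pos)

text \<open>After differentiating under the integral sign, integration by parts against \<open>cos t sin t\<close> removes \<open>V'\<close>. Since
  \<open>r\<close> is complex, this gives holomorphy in \<open>r\<close> at the same time.\<close>
lemma circle_average_deriv:
  fixes V :: "complex \<Rightarrow> complex"
  assumes V: "V holomorphic_on ball 0 1" and r: "r \<in> ball 0 1"
  shows "((\<lambda>r. r\<^sup>2 * integral {0..2*pi} (\<lambda>t. V (r * of_real (cos t)) * of_real ((sin t)\<^sup>2)))
      has_field_derivative r * integral {0..2*pi} (\<lambda>t. V (r * of_real (cos t)))) (at r)"
proof -
  have inball: "r * complex_of_real (cos t) \<in> ball 0 1" if "r \<in> ball 0 1" for r t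
  proof -
    have "norm (r * complex_of_real (cos t)) \<le> norm r * 1"
      unfolding norm_mult by (intro mult_left_mono) auto
    then show ?thesis using that by simp
  qed
  have dV: "deriv V holomorphic_on ball 0 1" using V by (intro holomorphic_deriv) auto
  have Vd: "(V has_field_derivative deriv V z) (at z)" if "z \<in> ball 0 1" for z
    using V that by (intro holomorphic_derivI) auto
  have cV: "continuous_on S (\<lambda>x. V (f x))" and cdV: "continuous_on S (\<lambda>x. deriv V (f x))"
    if "continuous_on S f" "f ` S \<subseteq> ball 0 1" for S and f :: "'b::topological_space \<Rightarrow> complex"
    using continuous_on_compose2[OF holomorphic_on_imp_continuous_on[OF V] that]
      continuous_on_compose2[OF holomorphic_on_imp_continuous_on[OF dV] that] .
  define f where "f = (\<lambda>r t. V (r * of_real (cos t)) * of_real ((sin t)\<^sup>2))"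
  define f' where "f' = (\<lambda>r t. deriv V (r * of_real (cos t)) * of_real (cos t) * of_real ((sin t)\<^sup>2))"
  define M where "M = (\<lambda>r. integral (cbox 0 (2*pi)) (f r))"
  define N where "N = integral (cbox 0 (2*pi)) (f' r)"
  have "(M has_field_derivative N) (at r within ball 0 1)"
    unfolding M_def N_def
  proof (rule leibniz_rule_field_derivative[of "ball 0 1" 0 "2*pi" f f' r])
    fix x :: complex and t :: real assume x: "x \<in> ball 0 1"
    have "((\<lambda>x. x * complex_of_real (cos t)) has_field_derivative of_real (cos t)) (at x)"
      by (auto intro!: derivative_eq_intros)
    from DERIV_cmult_right[OF DERIV_chain2[OF Vd[OF inball[OF x]] this]]
    show "((\<lambda>x. f x t) has_field_derivative f' x t) (at x within ball 0 1)"
      unfolding f_def f'_def by (rule has_field_derivative_at_within)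
  next
    fix x :: complex assume x: "x \<in> ball 0 1"
    show "f x integrable_on cbox 0 (2*pi)"
      unfolding f_def by (intro integrable_continuous continuous_intros cV) (use inball[OF x] in auto)
  next
    show "continuous_on (ball 0 1 \<times> cbox 0 (2*pi)) (\<lambda>(x, t). f' x t)"
      unfolding case_prod_unfold f'_def
      by (intro continuous_intros cdV) (use inball in auto)
  qed (use r in auto)
  then have M: "(M has_field_derivative N) (at r)"
    using r by (simp add: at_within_open[of r "ball 0 1"])
  have by_parts: "((\<lambda>t. (of_real (- sin t) * r * deriv V (r * of_real (cos t))) * of_real (cos t * sin t)
        + V (r * of_real (cos t)) * of_real ((cos t)\<^sup>2 - (sin t)\<^sup>2)) has_integral 0) {0..2*pi}"
  proof -
    have "((\<lambda>t. V (r * of_real (cos t)) * of_real ((cos t)\<^sup>2 - (sin t)\<^sup>2)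
        + (of_real (- sin t) * r * deriv V (r * of_real (cos t))) * of_real (cos t * sin t))
        has_integral (V (r * of_real (cos (2*pi))) * of_real (cos (2*pi) * sin (2*pi))
          - V (r * of_real (cos 0)) * of_real (cos 0 * sin 0))) {0..2*pi}"
    proof (rule fundamental_theorem_of_calculus)
      fix t :: real
      have 1: "((\<lambda>t. r * of_real (cos t)) has_vector_derivative of_real (- sin t) * r) (at t)"
        by (rule has_vector_derivative_eq_rhs, rule has_vector_derivative_mult_right, rule has_vector_derivative_of_real)
           (auto intro!: derivative_eq_intros simp flip: has_real_derivative_iff_has_vector_derivative)
      have 2: "((\<lambda>t. V (r * of_real (cos t))) has_vector_derivative
          of_real (- sin t) * r * deriv V (r * of_real (cos t))) (at t)"
        using field_vector_diff_chain_at[OF 1 Vd[OF inball[OF r]]] by (simp add: o_def)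
      have 3: "((\<lambda>t. complex_of_real (cos t * sin t)) has_vector_derivative
          of_real ((cos t)\<^sup>2 - (sin t)\<^sup>2)) (at t)"
        by (rule has_vector_derivative_of_real)
           (auto intro!: derivative_eq_intros simp: power2_eq_square simp flip: has_real_derivative_iff_has_vector_derivative)
      show "((\<lambda>t. V (r * of_real (cos t)) * of_real (cos t * sin t)) has_vector_derivative
          V (r * of_real (cos t)) * of_real ((cos t)\<^sup>2 - (sin t)\<^sup>2)
          + (of_real (- sin t) * r * deriv V (r * of_real (cos t))) * of_real (cos t * sin t))
          (at t within {0..2*pi})"
        by (rule has_vector_derivative_at_within[OF has_vector_derivative_mult[OF 2 3]])
    qed simp
    then show ?thesis by (simp add: add.commute)
  qed
  have int: "(\<lambda>t. V (r * of_real (cos t)) * of_real (f t)) integrable_on {0..2*pi}"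
      "(\<lambda>t. deriv V (r * of_real (cos t)) * of_real (cos t) * of_real (f t)) integrable_on {0..2*pi}"
    if "continuous_on UNIV f" for f :: "real \<Rightarrow> real"
    using that by (intro integrable_continuous_real continuous_intros cV cdV; use inball[OF r] in \<open>auto intro: continuous_on_subset\<close>)+
  have "0 = integral {0..2*pi} (\<lambda>t. (of_real (- sin t) * r * deriv V (r * of_real (cos t))) * of_real (cos t * sin t)
        + V (r * of_real (cos t)) * of_real ((cos t)\<^sup>2 - (sin t)\<^sup>2))"
    using by_parts by (simp add: integral_unique)
  also have "\<dots> = integral {0..2*pi} (\<lambda>t. (- r) * (deriv V (r * of_real (cos t)) * of_real (cos t) * of_real ((sin t)\<^sup>2))
        + (V (r * of_real (cos t)) * of_real 1 - 2 * (V (r * of_real (cos t)) * of_real ((sin t)\<^sup>2))))"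
  proof (intro integral_cong)
    fix t :: real
    have trig: "complex_of_real ((cos t)\<^sup>2 - (sin t)\<^sup>2) = 1 - 2 * of_real ((sin t)\<^sup>2)"
      by (simp add: cos_squared_eq)
    show "(of_real (- sin t) * r * deriv V (r * of_real (cos t))) * of_real (cos t * sin t)
        + V (r * of_real (cos t)) * of_real ((cos t)\<^sup>2 - (sin t)\<^sup>2)
      = (- r) * (deriv V (r * of_real (cos t)) * of_real (cos t) * of_real ((sin t)\<^sup>2))
        + (V (r * of_real (cos t)) * of_real 1 - 2 * (V (r * of_real (cos t)) * of_real ((sin t)\<^sup>2)))"
      unfolding trig by (simp add: algebra_simps power2_eq_square)
  qed
  also have "\<dots> = (- r) * N + (integral {0..2*pi} (\<lambda>t. V (r * of_real (cos t)) * of_real 1) - 2 * M r)"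
    unfolding N_def M_def f_def f'_def box_real
    by (subst integral_add integral_diff integral_mult_right,
        (intro integrable_diff integrable_on_mult_right int continuous_intros)+)+ simp
  finally have eq: "integral {0..2*pi} (\<lambda>t. V (r * of_real (cos t))) = 2 * M r + r * N"
    by (simp add: diff_eq_eq add.commute)
  have "((\<lambda>r. r\<^sup>2 * M r) has_field_derivative 2 * r * M r + r\<^sup>2 * N) (at r)"
    by (rule derivative_eq_intros M refl)+ simp
  also have "2 * r * M r + r\<^sup>2 * N = r * integral {0..2*pi} (\<lambda>t. V (r * of_real (cos t)))"
    unfolding eq by (simp add: power2_eq_square algebra_simps)
  finally show ?thesis unfolding M_def f_def box_real .
qed

text \<open>With \<open>W = sqrt (6 h) cos t\<close> and \<open>y = sqrt (2 h) sin t\<close>, the form \<open>(x + 1) ^ k y dx\<close> pulls back to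
  minus the integrand of \<open>J k h\<close>, and \<open>(x + 1) ^ k dx / y\<close> to minus that of \<open>J' k h\<close>.\<close>
definition J :: "int \<Rightarrow> real \<Rightarrow> real" where
  "J k h = 2 * sqrt 3 * h * integral {0..2*pi} (\<lambda>t. oval_weight k (sqrt (6 * h) * cos t) * (sin t)\<^sup>2)"

definition J' :: "int \<Rightarrow> real \<Rightarrow> real" where
  "J' k h = sqrt 3 * integral {0..2*pi} (\<lambda>t. oval_weight k (sqrt (6 * h) * cos t))"

lemma abs_mult_cos_less_1: "\<bar>r * cos t\<bar> < 1" if "\<bar>r\<bar> < 1" for r t :: real
proof -
  have "\<bar>r * cos t\<bar> \<le> \<bar>r\<bar> * 1" unfolding abs_mult by (intro mult_left_mono) auto
  then show ?thesis using that by simp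
qed

lemma continuous_on_oval_weight_cos:
  assumes "\<bar>r\<bar> < 1"
  shows "continuous_on S (\<lambda>t. oval_weight k (r * cos t))"
proof (rule continuous_on_compose2[OF continuous_oval_weight])
  show "(\<lambda>t. r * cos t) ` S \<subseteq> {-1<..<1}"
    using abs_mult_cos_less_1[OF assms] by (auto simp: abs_less_iff minus_less_iff)
qed (intro continuous_intros)

lemma J_analytic_and_deriv:
  assumes h: "h \<in> {0<..<1/6}"
  shows "analytic_at_real (J k) h" and "(J k has_real_derivative J' k h) (at h)"
proof -
  define V where "V = oval_weight_complex k"
  define S where "S = (\<lambda>r. r\<^sup>2 * integral {0..2*pi} (\<lambda>t. V (r * of_real (cos t)) * of_real ((sin t)\<^sup>2)))"
  define R where "R = (\<lambda>r. r\<^sup>2 * integral {0..2*pi} (\<lambda>t. oval_weight k (r * cos t) * (sin t)\<^sup>2))"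
  define T where "T = (\<lambda>r. r * integral {0..2*pi} (\<lambda>t. oval_weight k (r * cos t)))"
  have S: "(S has_field_derivative r * integral {0..2*pi} (\<lambda>t. V (r * of_real (cos t)))) (at r)"
    if "r \<in> ball 0 1" for r
    unfolding S_def V_def using that by (intro circle_average_deriv oval_weight_complex_holomorphic)
  then have "S holomorphic_on ball 0 1"
    unfolding holomorphic_on_open[OF open_ball] by blast
  have S_real: "S (of_real r) = of_real (R r)" and T_real:
      "of_real r * integral {0..2*pi} (\<lambda>t. V (of_real r * of_real (cos t))) = of_real (T r)"
    if r: "\<bar>r\<bar> < 1" for r
  proof -
    have V: "V (of_real r * of_real (cos t)) = of_real (oval_weight k (r * cos t))" for t
      unfolding V_def using oval_weight_complex_of_real[OF abs_mult_cos_less_1[OF r], of k t] by simp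
    have "((\<lambda>t. complex_of_real (oval_weight k (r * cos t) * (sin t)\<^sup>2)) has_integral
        of_real (integral {0..2*pi} (\<lambda>t. oval_weight k (r * cos t) * (sin t)\<^sup>2))) {0..2*pi}"
      by (intro has_integral_of_real integrable_integral integrable_continuous_real continuous_intros
          continuous_on_oval_weight_cos r)
    from integral_unique[OF this] show "S (of_real r) = of_real (R r)"
      by (simp add: S_def R_def V)
    have "((\<lambda>t. complex_of_real (oval_weight k (r * cos t))) has_integral
        of_real (integral {0..2*pi} (\<lambda>t. oval_weight k (r * cos t)))) {0..2*pi}"
      by (intro has_integral_of_real integrable_integral integrable_continuous_real continuous_intros
          continuous_on_oval_weight_cos r)
    from integral_unique[OF this]
    show "of_real r * integral {0..2*pi} (\<lambda>t. V (of_real r * of_real (cos t))) = of_real (T r)"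
      by (simp add: T_def V)
  qed
  define r where "r = sqrt (6 * h)"
  have r: "r > 0" "\<bar>r\<bar> < 1" "r\<^sup>2 = 6 * h" using h by (auto simp: r_def)
  have anS: "S analytic_on {complex_of_real r}"
    using \<open>S holomorphic_on ball 0 1\<close> by (rule holomorphic_on_imp_analytic_at) (use r in auto)
  have "eventually (\<lambda>r. r \<in> {-1<..<1}) (nhds r)"
    using r by (intro eventually_nhds_in_open) auto
  then have ev: "eventually (\<lambda>r. S (complex_of_real r) = complex_of_real (R r)) (nhds r)"
    by eventually_elim (intro S_real, auto)
  have "deriv S (of_real r) = of_real (T r)"
    using S[of "of_real r"] r T_real[OF r(2)] by (simp add: DERIV_imp_deriv)
  then have R: "(R has_real_derivative T r) (at r)"
    using extension_derivative(1)[OF anS ev] by simp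
  have anR: "analytic_at_real R r"
    using anS ev unfolding analytic_at_real_def by blast
  have J_R: "J k x = 1 / sqrt 3 * R (sqrt (6 * x))" if "x \<in> {0<..<1/6}" for x
    using that by (simp add: J_def R_def field_simps)
  have an_sqrt: "analytic_at_real (\<lambda>h. sqrt (6 * h)) h"
    using analytic_at_real_sqrt_affine[of 0 6 h] h by simp
  have "analytic_at_real (\<lambda>h. 1 / sqrt 3 * R (sqrt (6 * h))) h"
    by (intro analytic_at_real_mult analytic_at_real_const an_sqrt
        analytic_at_real_compose[where f = R and g = "\<lambda>h. sqrt (6 * h)"] anR[unfolded r_def])
  then show "analytic_at_real (J k) h"
    by (rule analytic_at_real_cong_open[OF open_greaterThanLessThan h, rotated]) (simp add: J_R)
  have sq: "((\<lambda>h. sqrt (6 * h)) has_real_derivative 3 / r) (at h)"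
    unfolding r_def using h by (auto intro!: derivative_eq_intros simp: field_simps)
  have d: "((\<lambda>h. 1 / sqrt 3 * R (sqrt (6 * h))) has_real_derivative 1 / sqrt 3 * (T r * (3 / r))) (at h)"
    by (rule DERIV_cmult[OF DERIV_chain2[OF R[unfolded r_def] sq, folded r_def]])
  have val: "1 / sqrt 3 * (T r * (3 / r)) = J' k h"
  proof -
    define A where "A = integral {0..2*pi} (\<lambda>t. oval_weight k (r * cos t))"
    have "T r = r * A" "J' k h = sqrt 3 * A" by (simp_all only: T_def J'_def A_def r_def)
    then show ?thesis using r(1) by (simp add: divide_simps)
  qed
  have ev: "eventually (\<lambda>x. 1 / sqrt 3 * R (sqrt (6 * x)) = J k x) (nhds h)"
    using eventually_nhds_in_open[OF open_greaterThanLessThan h] by eventually_elim (simp only: J_R)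
  show "(J k has_real_derivative J' k h) (at h)"
    using d unfolding DERIV_cong_ev[OF refl ev refl] val .
qed

lemma J'_analytic:
  assumes h: "h \<in> {0<..<1/6}"
  shows "analytic_at_real (J' k) h"
  by (rule analytic_at_real_cong_open[OF open_greaterThanLessThan h _
        analytic_at_real_deriv[OF J_analytic_and_deriv(1)[OF h]]])
     (use J_analytic_and_deriv(2) DERIV_imp_deriv in blast)

text \<open>Integral of the exact form \<open>d (u ^ (k + 1) y)\<close> over the oval, where \<open>u = x + 1\<close> and
  \<open>y dy = (u - u\<^sup>2) du\<close>.\<close>
lemma J_by_parts:
  assumes h: "h \<in> {0<..<1/6}"
  shows "(k + 1) * J k h = J' (k + 3) h - J' (k + 2) h"
proof -
  define r where "r = sqrt (6 * h)"
  have r: "r > 0" "\<bar>r\<bar> < 1" "r\<^sup>2 = 6 * h" using h by (auto simp: r_def)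
  have W: "\<bar>r * cos t\<bar> < 1" for t using abs_mult_cos_less_1[OF r(2)] .
  let ?I = "\<lambda>f. integral {0..2*pi} f"
  define A B C where "A = (\<lambda>t. oval_weight k (r * cos t) * (sin t)\<^sup>2)"
    and "B = (\<lambda>t. oval_weight (k + 2) (r * cos t))" and "C = (\<lambda>t. oval_weight (k + 3) (r * cos t))"
  have int: "A integrable_on {0..2*pi}" "B integrable_on {0..2*pi}" "C integrable_on {0..2*pi}"
    unfolding A_def B_def C_def
    by (intro integrable_continuous_real continuous_intros continuous_on_oval_weight_cos r)+
  have "((\<lambda>t. 3 / r * (C t - B t) - (k + 1) * r * A t) has_integral
      (u_oval (r * cos (2*pi)) powi (k + 1) * sin (2*pi) - u_oval (r * cos 0) powi (k + 1) * sin 0)) {0..2*pi}"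
  proof (rule fundamental_theorem_of_calculus)
    fix t :: real
    let ?U = "u_oval (r * cos t)" and ?U' = "u_oval' (r * cos t)"
    have U: "?U > 0" using u_oval_pos[OF W] .
    have cos: "cos t = 3 / r * (?U\<^sup>2 - ?U) * ?U'"
      using u_oval'_relation[OF W, of t] r(1) by (simp add: field_simps)
    have "((\<lambda>t. r * cos t) has_real_derivative - r * sin t) (at t)"
      by (auto intro!: derivative_eq_intros)
    from DERIV_chain2[OF u_oval_deriv[OF W] this]
    have "((\<lambda>t. u_oval (r * cos t)) has_real_derivative ?U' * (- r * sin t)) (at t)" .
    then have "((\<lambda>t. u_oval (r * cos t) powi (k + 1) * sin t) has_real_derivative
        (k + 1) * ?U powi k * (?U' * (- r * sin t)) * sin t + ?U powi (k + 1) * cos t) (at t)"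
      using U by (auto intro!: derivative_eq_intros)
    also have "(k + 1) * ?U powi k * (?U' * (- r * sin t)) * sin t + ?U powi (k + 1) * cos t
        = 3 / r * (C t - B t) - (k + 1) * r * A t"
    proof -
      have p: "?U powi (k + 1) = ?U powi k * ?U" "?U powi (k + 2) = ?U powi k * ?U\<^sup>2"
          "?U powi (k + 3) = ?U powi k * ?U ^ 3"
        using U power_int_add[of ?U k 2] power_int_add[of ?U k 3] by (auto simp: power_int_add)
      have "?U powi (k + 1) * cos t = ?U powi (k + 1) * (3 / r * (?U\<^sup>2 - ?U) * ?U')"
        by (rule arg_cong[OF cos])
      also have "\<dots> = 3 / r * (C t - B t)"
        unfolding C_def B_def oval_weight_def p using r(1)
        by (simp add: field_simps power2_eq_square power3_eq_cube)
      finally have "?U powi (k + 1) * cos t = 3 / r * (C t - B t)" .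
      then show ?thesis
        unfolding A_def oval_weight_def by (simp add: power2_eq_square)
    qed
    finally show "((\<lambda>t. u_oval (r * cos t) powi (k + 1) * sin t) has_vector_derivative
        3 / r * (C t - B t) - (k + 1) * r * A t) (at t within {0..2*pi})"
      by (simp add: has_real_derivative_iff_has_vector_derivative has_vector_derivative_at_within)
  qed simp
  then have "?I (\<lambda>t. 3 / r * (C t - B t) - (k + 1) * r * A t) = 0"
    by (simp add: integral_unique)
  moreover have "?I (\<lambda>t. 3 / r * (C t - B t) - (k + 1) * r * A t) = 3 / r * (?I C - ?I B) - (k + 1) * r * ?I A"
  proof -
    have "?I (\<lambda>t. 3 / r * (C t - B t) - (k + 1) * r * A t)
        = ?I (\<lambda>t. 3 / r * (C t - B t)) - ?I (\<lambda>t. (k + 1) * r * A t)"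
      by (intro integral_diff integrable_on_mult_right integrable_diff int)
    also have "?I (\<lambda>t. 3 / r * (C t - B t)) = 3 / r * (?I C - ?I B)"
      by (simp add: integral_diff int)
    finally show ?thesis by simp
  qed
  ultimately have "(k + 1) * r\<^sup>2 * ?I A = 3 * (?I C - ?I B)"
    using r(1) by (simp add: field_simps power2_eq_square)
  then have "(k + 1) * (6 * h) * ?I A = 3 * (?I C - ?I B)" using r(3) by simp
  moreover have "J k h = 2 * sqrt 3 * h * ?I A" "J' (k + 3) h = sqrt 3 * ?I C" "J' (k + 2) h = sqrt 3 * ?I B"
    by (simp_all add: J_def J'_def A_def B_def C_def r_def)
  moreover have "sqrt 3 * ((k + 1) * (6 * h) * ?I A) = sqrt 3 * (3 * (?I C - ?I B))"
    using calculation(1) by (rule arg_cong)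
  ultimately show ?thesis by (simp add: algebra_simps)
qed

text \<open>Obtained by writing \<open>y = y\<^sup>2 / y\<close> and substituting the equation of the oval.\<close>
lemma J_level:
  assumes h: "h \<in> {0<..<1/6}"
  shows "3 * J k h = - (1 - 6 * h) * J' k h + 3 * J' (k + 2) h - 2 * J' (k + 3) h"
proof -
  define r where "r = sqrt (6 * h)"
  have r: "r > 0" "\<bar>r\<bar> < 1" "r\<^sup>2 = 6 * h" using h by (auto simp: r_def)
  have W: "\<bar>r * cos t\<bar> < 1" for t using abs_mult_cos_less_1[OF r(2)] .
  let ?I = "\<lambda>f. integral {0..2*pi} f"
  define E where "E = (\<lambda>k t. oval_weight k (r * cos t))"
  have int: "E k integrable_on {0..2*pi}" for k
    unfolding E_def by (intro integrable_continuous_real continuous_on_oval_weight_cos r)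
  have "6 * h * (E k t * (sin t)\<^sup>2) = - (1 - 6 * h) * E k t + (3 * E (k + 2) t - 2 * E (k + 3) t)" for t
  proof -
    let ?U = "u_oval (r * cos t)"
    have p: "?U powi (k + 2) = ?U powi k * ?U\<^sup>2" "?U powi (k + 3) = ?U powi k * ?U ^ 3"
      using u_oval_pos[OF W, of t] power_int_add[of ?U k 2] power_int_add[of ?U k 3] by auto
    have "6 * h * (sin t)\<^sup>2 = 6 * h - (r * cos t)\<^sup>2"
      by (simp add: power_mult_distrib r(3) sin_squared_eq algebra_simps)
    also have "\<dots> = 6 * h - (2 * ?U ^ 3 - 3 * ?U\<^sup>2 + 1)"
      using u_oval_cubic[of "r * cos t"] W[of t] by simp
    finally have "6 * h * (sin t)\<^sup>2 * E k t = (6 * h - (2 * ?U ^ 3 - 3 * ?U\<^sup>2 + 1)) * E k t" by simp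
    then show ?thesis unfolding E_def oval_weight_def p by (simp add: algebra_simps)
  qed
  then have "?I (\<lambda>t. 6 * h * (E k t * (sin t)\<^sup>2)) = ?I (\<lambda>t. - (1 - 6 * h) * E k t + (3 * E (k + 2) t - 2 * E (k + 3) t))"
    by simp
  also have "\<dots> = ?I (\<lambda>t. - (1 - 6 * h) * E k t) + ?I (\<lambda>t. 3 * E (k + 2) t - 2 * E (k + 3) t)"
    by (intro integral_add integrable_on_mult_right integrable_diff int)
  also have "?I (\<lambda>t. 3 * E (k + 2) t - 2 * E (k + 3) t) = ?I (\<lambda>t. 3 * E (k + 2) t) - ?I (\<lambda>t. 2 * E (k + 3) t)"
    by (intro integral_diff integrable_on_mult_right int)
  finally have "6 * h * ?I (\<lambda>t. E k t * (sin t)\<^sup>2) = - (1 - 6 * h) * ?I (E k) + 3 * ?I (E (k + 2)) - 2 * ?I (E (k + 3))"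
    by simp
  then have "sqrt 3 * (6 * h * ?I (\<lambda>t. E k t * (sin t)\<^sup>2))
      = sqrt 3 * (- (1 - 6 * h) * ?I (E k) + 3 * ?I (E (k + 2)) - 2 * ?I (E (k + 3)))" by simp
  moreover have "J k h = 2 * sqrt 3 * h * ?I (\<lambda>t. E k t * (sin t)\<^sup>2)" "J' k h = sqrt 3 * ?I (E k)" for k
    by (simp_all add: J_def J'_def E_def r_def)
  ultimately show ?thesis by (simp add: algebra_simps)
qed

lemma J_pos:
  assumes h: "h \<in> {0<..<1/6}"
  shows "J k h > 0" and "J' k h > 0"
proof -
  define r where "r = sqrt (6 * h)"
  have r: "\<bar>r\<bar> < 1" using h by (auto simp: r_def)
  have pos: "oval_weight k (r * cos t) > 0" for t
    by (rule oval_weight_pos[OF abs_mult_cos_less_1[OF r]])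
  have cont: "continuous_on {0..2*pi} (\<lambda>t. oval_weight k (r * cos t) * (sin t)\<^sup>2)"
      "continuous_on {0..2*pi} (\<lambda>t. oval_weight k (r * cos t))"
    by (intro continuous_intros continuous_on_oval_weight_cos r)+
  have "integral {0..2*pi} (\<lambda>t. oval_weight k (r * cos t) * (sin t)\<^sup>2) \<noteq> 0"
  proof
    assume "integral {0..2*pi} (\<lambda>t. oval_weight k (r * cos t) * (sin t)\<^sup>2) = 0"
    then have "\<forall>t\<in>{0..2*pi}. oval_weight k (r * cos t) * (sin t)\<^sup>2 = 0"
      by (subst integral_eq_0_iff[OF cont(1), symmetric]) (simp_all add: less_imp_le[OF pos])
    then have "oval_weight k (r * cos (pi/2)) * (sin (pi/2))\<^sup>2 = 0"
      by (rule bspec) auto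
    then show False using pos[of "pi/2"] by simp
  qed
  moreover have "integral {0..2*pi} (\<lambda>t. oval_weight k (r * cos t) * (sin t)\<^sup>2) \<ge> 0"
    by (intro integral_nonneg integrable_continuous_real cont mult_nonneg_nonneg
        less_imp_le[OF pos] zero_le_power2)
  ultimately show "J k h > 0" using h by (simp add: J_def r_def)
  have "integral {0..2*pi} (\<lambda>t. oval_weight k (r * cos t)) \<noteq> 0"
  proof
    assume "integral {0..2*pi} (\<lambda>t. oval_weight k (r * cos t)) = 0"
    then have "\<forall>t\<in>{0..2*pi}. oval_weight k (r * cos t) = 0"
      by (subst integral_eq_0_iff[OF cont(2), symmetric]) (simp_all add: less_imp_le[OF pos])
    then have "oval_weight k (r * cos (pi/2)) = 0"
      using bspec[of "{0..2*pi}" "\<lambda>t. oval_weight k (r * cos t) = 0" "pi/2"] by simp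
    then show False using pos[of "pi/2"] by simp
  qed
  moreover have "integral {0..2*pi} (\<lambda>t. oval_weight k (r * cos t)) \<ge> 0"
    by (intro integral_nonneg integrable_continuous_real cont mult_nonneg_nonneg
        less_imp_le[OF pos] zero_le_power2)
  ultimately show "J' k h > 0" by (simp add: J'_def r_def)
qed

lemma J_bounded_near_0:
  obtains C where "C > 0" "\<And>h. h \<in> {0<..1/12} \<Longrightarrow> J k h \<le> C * h" "\<And>h. h \<in> {0<..1/12} \<Longrightarrow> J' k h \<le> C"
proof -
  define q where "q = sqrt (1/2)"
  have "q < 1" by (simp add: q_def real_sqrt_lt_1_iff)
  have "compact (oval_weight k ` {-q..q})"
    using \<open>q < 1\<close> by (intro compact_continuous_image continuous_on_subset[OF continuous_oval_weight]) auto
  then obtain B where B: "B > 0" "\<And>W. W \<in> {-q..q} \<Longrightarrow> \<bar>oval_weight k W\<bar> \<le> B"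
    using bounded_pos[of "oval_weight k ` {-q..q}"] compact_imp_bounded by auto
  have bd: "\<bar>oval_weight k (sqrt (6 * h) * cos t)\<bar> \<le> B" if h: "h \<in> {0<..1/12}" for h t
  proof -
    have "\<bar>sqrt (6 * h) * cos t\<bar> \<le> q * 1"
      unfolding abs_mult q_def using h by (intro mult_mono) auto
    then show ?thesis by (intro B) (auto simp: abs_le_iff)
  qed
  have le: "integral {0..2*pi} f \<le> B * (2 * pi)"
    if "continuous_on {0..2*pi} f" "\<And>t. \<bar>f t\<bar> \<le> B" for f :: "real \<Rightarrow> real"
    using integral_bound[of 0 "2*pi" f B] that by fastforce
  show thesis
  proof
    show "2 * sqrt 3 * (B * (2 * pi)) > 0" using B by simp
    fix h :: real assume h: "h \<in> {0<..1/12}"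
    have r: "\<bar>sqrt (6 * h)\<bar> < 1" using h by simp
    have "integral {0..2*pi} (\<lambda>t. oval_weight k (sqrt (6 * h) * cos t) * (sin t)\<^sup>2) \<le> B * (2 * pi)"
    proof (rule le)
      show "\<bar>oval_weight k (sqrt (6 * h) * cos t) * (sin t)\<^sup>2\<bar> \<le> B" for t
      proof -
        have "\<bar>oval_weight k (sqrt (6 * h) * cos t)\<bar> * \<bar>(sin t)\<^sup>2\<bar> \<le> B * 1"
          using B by (intro mult_mono bd h) (auto simp: power_le_one abs_square_le_1)
        then show ?thesis by (simp add: abs_mult)
      qed
    qed (intro continuous_intros continuous_on_oval_weight_cos r)
    then have "2 * sqrt 3 * h * integral {0..2*pi} (\<lambda>t. oval_weight k (sqrt (6 * h) * cos t) * (sin t)\<^sup>2)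
        \<le> 2 * sqrt 3 * h * (B * (2 * pi))"
      using h by (intro mult_left_mono) auto
    then show "J k h \<le> 2 * sqrt 3 * (B * (2 * pi)) * h"
      by (simp add: J_def mult_ac)
    have "integral {0..2*pi} (\<lambda>t. oval_weight k (sqrt (6 * h) * cos t)) \<le> B * (2 * pi)"
      by (rule le[OF continuous_on_oval_weight_cos[OF r] bd[OF h]])
    then have "sqrt 3 * integral {0..2*pi} (\<lambda>t. oval_weight k (sqrt (6 * h) * cos t)) \<le> sqrt 3 * (B * (2 * pi))"
      by (intro mult_left_mono) auto
    also have "\<dots> \<le> 2 * sqrt 3 * (B * (2 * pi))" using B by simp
    finally show "J' k h \<le> 2 * sqrt 3 * (B * (2 * pi))" by (simp add: J'_def)
  qed
qed

lemma J_tendsto_0: "(J k \<longlongrightarrow> 0) (at_right 0)"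
  and J'_tendsto_0: "((\<lambda>h. h * J' k h) \<longlongrightarrow> 0) (at_right 0)"
proof -
  obtain C where C: "C > 0" "\<And>h. h \<in> {0<..1/12} \<Longrightarrow> J k h \<le> C * h"
      "\<And>h. h \<in> {0<..1/12} \<Longrightarrow> J' k h \<le> C"
    by (rule J_bounded_near_0[of k]) blast
  have ev: "eventually (\<lambda>h::real. h \<in> {0<..<1/12}) (at_right 0)"
    by (rule eventually_at_right_real) simp
  have "((\<lambda>h. C * h) \<longlongrightarrow> C * 0) (at_right 0)" by (intro tendsto_intros)
  then have lim: "((\<lambda>h. C * h) \<longlongrightarrow> 0) (at_right 0)" by simp
  have "eventually (\<lambda>h. norm (J k h) \<le> C * h) (at_right 0)"
    using ev
  proof eventually_elim
    case (elim h)
    then have "0 < J k h" "J k h \<le> C * h" using C(2)[of h] J_pos(1)[of h k] by auto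
    then show ?case by simp
  qed
  then show "(J k \<longlongrightarrow> 0) (at_right 0)" using lim by (rule Lim_null_comparison)
  have "eventually (\<lambda>h. norm (h * J' k h) \<le> C * h) (at_right 0)"
    using ev
  proof eventually_elim
    case (elim h)
    then have "0 < J' k h" "J' k h \<le> C" using C(3)[of h] J_pos(2)[of h k] by auto
    then show ?case using elim by (simp add: abs_mult mult.commute)
  qed
  then show "((\<lambda>h. h * J' k h) \<longlongrightarrow> 0) (at_right 0)" using lim by (rule Lim_null_comparison)
qed

text \<open>The first three equations combine the two families of relations for \<open>k = -3, -2, -1\<close>. The equation for \<open>J' 1\<close> comes from
  differentiating \<open>7 J 1 = J 0 + 6 h J' 1\<close>, a consequence of the relations for \<open>k = -1, 0, 1\<close>.\<close>
lemma annulus_integrals_J: "annulus_integrals (J (-3)) (J (-2)) (J (-1)) (J' 1)"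
proof
  fix h :: real assume h: "h \<in> {0<..<1/6}"
  have t: "1 - 6 * h > 0" "h > 0" using h by auto
  have parts: "- 2 * J (-3) h = J' 0 h - J' (-1) h" "- J (-2) h = J' 1 h - J' 0 h" "J' 2 h = J' 1 h"
    using J_by_parts[OF h, of "-3"] J_by_parts[OF h, of "-2"] J_by_parts[OF h, of "-1"] by simp_all
  have level: "3 * J (-3) h = - (1 - 6 * h) * J' (-3) h + 3 * J' (-1) h - 2 * J' 0 h"
      "3 * J (-2) h = - (1 - 6 * h) * J' (-2) h + 3 * J' 0 h - 2 * J' 1 h"
      "3 * J (-1) h = - (1 - 6 * h) * J' (-1) h + 3 * J' 1 h - 2 * J' 2 h"
    using J_level[OF h, of "-3"] J_level[OF h, of "-2"] J_level[OF h, of "-1"] by simp_all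
  have mult: "(1 - 6 * h) * J' (-3) h = 3 * J (-3) h + J (-2) h + J' 1 h"
      "(1 - 6 * h) * J' (-2) h = J' 1 h" "(1 - 6 * h) * J' (-1) h = J' 1 h - 3 * J (-1) h"
    using parts level by linarith+
  have div: "x = y / (1 - 6 * h)" if "(1 - 6 * h) * x = y" for x y
    using that t by auto
  have "J' (-3) h = (3 * J (-3) h + J (-2) h + J' 1 h) / (1 - 6 * h)"
       "J' (-2) h = J' 1 h / (1 - 6 * h)"
       "J' (-1) h = (J' 1 h - 3 * J (-1) h) / (1 - 6 * h)"
    by (rule div, rule mult)+
  then show "(J (-3) has_real_derivative (3 * J (-3) h + J (-2) h + J' 1 h) / (1 - 6 * h)) (at h)"
      "(J (-2) has_real_derivative J' 1 h / (1 - 6 * h)) (at h)"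
      "(J (-1) has_real_derivative (J' 1 h - 3 * J (-1) h) / (1 - 6 * h)) (at h)"
    using J_analytic_and_deriv(2)[OF h] by metis+
  show "(J' 1 has_real_derivative - J (-2) h / (6 * h)) (at h)"
  proof -
    define K' where "K' = deriv (J' 1) h"
    have K': "(J' 1 has_real_derivative K') (at h)"
      unfolding K'_def by (rule analytic_at_real_has_derivative[OF J'_analytic[OF h]])
    have eq: "7 * J 1 x = J 0 x + 6 * x * J' 1 x" if x: "x \<in> {0<..<1/6}" for x
      using J_by_parts[OF x, of 0] J_by_parts[OF x, of 1] J_by_parts[OF x, of "-1"] J_level[OF x, of 1]
      by (simp add: algebra_simps)
    have "((\<lambda>x. J 0 x + 6 * x * J' 1 x) has_real_derivative J' 0 h + (6 * J' 1 h + 6 * h * K')) (at h)"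
      by (rule derivative_eq_intros J_analytic_and_deriv(2) h K' refl)+ simp
    moreover have "eventually (\<lambda>x. 7 * J 1 x = J 0 x + 6 * x * J' 1 x) (nhds h)"
      using eventually_nhds_in_open[OF open_greaterThanLessThan h] by eventually_elim (rule eq)
    ultimately have "((\<lambda>x. 7 * J 1 x) has_real_derivative J' 0 h + (6 * J' 1 h + 6 * h * K')) (at h)"
      by (simp add: DERIV_cong_ev)
    moreover have "((\<lambda>x. 7 * J 1 x) has_real_derivative 7 * J' 1 h) (at h)"
      by (rule DERIV_cmult[OF J_analytic_and_deriv(2)[OF h]])
    ultimately have "J' 0 h + (6 * J' 1 h + 6 * h * K') = 7 * J' 1 h"
      by (rule DERIV_unique)
    then have "K' = - J (-2) h / (6 * h)"
      using parts(2) t by (simp add: field_simps)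
    then show ?thesis using K' by simp
  qed
next
  show "\<exists>C. \<forall>h\<in>{0<..1/12}. J (-2) h \<le> C * h"
    by (rule J_bounded_near_0[of "-2"]) blast
qed (use J_pos J_analytic_and_deriv(1) J'_analytic J_tendsto_0 J'_tendsto_0 in auto)

section \<open>Line integrals over the ovals\<close>

text \<open>The inverse of \<open>u_oval\<close>, as a function of \<open>x = u - 1\<close>. Together with \<open>sqrt 3 y\<close> it is a coordinate
  system of the period annulus in which the ovals are circles.\<close>
definition w_oval :: "real \<Rightarrow> real" where
  "w_oval x = cos (3 / 2 * arccos (x + 1 / 2))"

lemma arccos_annulus_bounds:
  assumes "-1 < x" "x < 1/2"
  shows "0 < arccos (x + 1 / 2)" "3 / 2 * arccos (x + 1 / 2) < pi"
proof -
  show "0 < arccos (x + 1 / 2)" using assms by (intro arccos_lt_bounded[THEN conjunct1]) auto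
  have "arccos (x + 1 / 2) < arccos (- 1 / 2)"
    using assms by (intro arccos_less_arccos) auto
  also have "arccos (- 1 / 2) = 2 * pi / 3"
    using arccos_cos[of "2 * pi / 3"] cos_120 by simp
  finally show "3 / 2 * arccos (x + 1 / 2) < pi" by simp
qed

lemma u_oval_w_oval:
  assumes "-1 < x" "x < 1/2"
  shows "u_oval (w_oval x) = x + 1"
proof -
  have "arccos (w_oval x) = 3 / 2 * arccos (x + 1 / 2)"
    unfolding w_oval_def using arccos_annulus_bounds[OF assms] by (intro arccos_cos) auto
  then have "2 / 3 * arccos (w_oval x) = arccos (x + 1 / 2)" by simp
  then show ?thesis
    unfolding u_oval_def using assms by (simp only:) simp
qed

lemma w_oval_square:
  assumes "-1 < x" "x < 1/2"
  shows "(w_oval x)\<^sup>2 = (2 * x + 3) * x\<^sup>2"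
proof -
  have "\<bar>w_oval x\<bar> \<le> 1" by (simp add: w_oval_def)
  from u_oval_cubic[OF this] show ?thesis
    unfolding u_oval_w_oval[OF assms] by (simp add: power2_eq_square power3_eq_cube algebra_simps)
qed

lemma w_oval_sign:
  assumes "-1 < x" "x < 1/2"
  shows "0 < x \<Longrightarrow> 0 < w_oval x" and "x < 0 \<Longrightarrow> w_oval x < 0"
proof -
  have pi3: "arccos (1 / 2) = pi / 3" using arccos_cos[of "pi / 3"] cos_60 by simp
  note b = arccos_annulus_bounds[OF assms]
  {
    assume "0 < x"
    then have "arccos (x + 1 / 2) < pi / 3"
      using assms arccos_less_arccos[of "1/2" "x + 1/2"] pi3 by simp
    then show "0 < w_oval x" unfolding w_oval_def using b by (intro cos_gt_zero) auto
  }
  assume "x < 0"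
  then have "pi / 3 < arccos (x + 1 / 2)"
    using assms arccos_less_arccos[of "x + 1/2" "1/2"] pi3 by simp
  then have "cos (3 / 2 * arccos (x + 1 / 2)) < cos (pi / 2)"
    using b by (intro cos_monotone_0_pi) auto
  then show "w_oval x < 0" by (simp add: w_oval_def)
qed

lemma w_oval_differentiable:
  assumes "-1 < x" "x < 1/2"
  obtains d where "(w_oval has_real_derivative d) (at x)"
proof -
  have "((\<lambda>x. cos (3 / 2 * arccos (x + 1 / 2))) has_real_derivative
      - sin (3 / 2 * arccos (x + 1 / 2)) * (3 / 2 * inverse (- sqrt (1 - (x + 1 / 2)\<^sup>2)))) (at x)"
    using assms by (auto intro!: derivative_eq_intros)
  then show ?thesis using that unfolding w_oval_def [abs_def] by blast
qed

lemma continuous_on_w_oval: "continuous_on {-1<..<1/2} w_oval"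
  unfolding w_oval_def [abs_def] by (intro continuous_intros) auto

text \<open>Near \<open>t\<close> a continuous logarithm differs from its value at \<open>t\<close> by the principal
  logarithm of a quotient close to \<open>1\<close>.\<close>
lemma has_vector_derivative_exp_lift:
  fixes q :: "real \<Rightarrow> complex"
  assumes q: "isCont q t" and c: "((\<lambda>s. exp (q s)) has_vector_derivative c') (at t)"
  shows "(q has_vector_derivative c' / exp (q t)) (at t)"
proof -
  have "((\<lambda>s. exp (q s) / exp (q t)) has_vector_derivative c' / exp (q t)) (at t)"
    using c by (rule has_vector_derivative_divide)
  moreover have "(Ln has_field_derivative inverse (exp (q t) / exp (q t))) (at (exp (q t) / exp (q t)))"
    by (rule has_field_derivative_Ln) simp
  ultimately have "((Ln \<circ> (\<lambda>s. exp (q s) / exp (q t))) has_vector_derivative c' / exp (q t) * 1) (at t)"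
    using field_vector_diff_chain_at[of "\<lambda>s. exp (q s) / exp (q t)" "c' / exp (q t)" t Ln 1] by simp
  then have d: "((\<lambda>s. q t + Ln (exp (q s) / exp (q t))) has_vector_derivative c' / exp (q t)) (at t)"
    using has_vector_derivative_add[OF has_vector_derivative_const] by (fastforce simp: o_def)
  have "((\<lambda>s. q s - q t) \<longlongrightarrow> q t - q t) (nhds t)"
    using q by (intro tendsto_intros) (simp add: isCont_def tendsto_at_iff_tendsto_nhds)
  then have "eventually (\<lambda>s. dist (q s - q t) 0 < pi) (nhds t)"
    by (intro tendstoD) auto
  then have ev: "eventually (\<lambda>s. s \<in> UNIV \<longrightarrow> q t + Ln (exp (q s) / exp (q t)) = q s) (nhds t)"
  proof eventually_elim
    case (elim s)
    then have "\<bar>Im (q s - q t)\<bar> < pi" using abs_Im_le_cmod[of "q s - q t"] by simp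
    then have "Ln (exp (q s - q t)) = q s - q t" by (intro Ln_exp) auto
    then show ?case by (simp add: exp_diff)
  qed
  show ?thesis
    using d has_vector_derivative_cong_ev[OF ev] by simp
qed

lemma oval_parametrization_level:
  assumes "oval_parametrization h g" "t \<in> {0..1}"
  shows "H (Re (g t)) (Im (g t)) = h" "-1 < Re (g t)" "Re (g t) < 1/2"
proof -
  have "g t \<in> path_image g" using assms(2) by (simp add: path_image_def)
  then have "g t \<in> {z. H (Re z) (Im z) = h \<and> -1 < Re z \<and> Re z < 1/2}"
    using assms(1) unfolding oval_parametrization_def by blast
  then show "H (Re (g t)) (Im (g t)) = h" "-1 < Re (g t)" "Re (g t) < 1/2" by auto
qed

text \<open>The coordinates \<open>(w_oval x, sqrt 3 y)\<close> turn the oval into a circle around \<open>0\<close>, whose continuous angle is \<open>\<phi>\<close>. The winding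
  number is unchanged: \<open>w_oval x\<close> has the sign of \<open>x\<close>, so the straight segments from the curve to its image
  avoid the origin.\<close>
lemma oval_rectification:
  assumes h: "h \<in> {0<..<1/6}" and g: "oval_parametrization h g"
  obtains \<phi> where "continuous_on {0..1} \<phi>"
    "\<And>t. t \<in> {0..1} \<Longrightarrow> w_oval (Re (g t)) = sqrt (6 * h) * cos (\<phi> t)"
    "\<And>t. t \<in> {0..1} \<Longrightarrow> Im (g t) = sqrt (2 * h) * sin (\<phi> t)"
    "\<phi> 1 - \<phi> 0 = 2 * pi * Re (winding_number g 0)"
    "\<And>t. t \<in> {0<..<1} \<Longrightarrow> g differentiable at t \<Longrightarrow> \<phi> differentiable at t"
proof -
  have path: "path g" and loop: "pathfinish g = pathstart g"
    using g valid_path_imp_path by (auto simp: oval_parametrization_def)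
  note on_oval = oval_parametrization_level[OF g]
  have contg: "continuous_on {0..1} g" using path by (simp add: path_def)
  define c where "c = (\<lambda>t. Complex (w_oval (Re (g t))) (sqrt 3 * Im (g t)))"
  have c_alt: "c = (\<lambda>t. complex_of_real (w_oval (Re (g t))) + \<i> * complex_of_real (sqrt 3 * Im (g t)))"
    by (simp add: c_def complex_eq_iff fun_eq_iff)
  have norm_c: "norm (c t) = sqrt (6 * h)" if "t \<in> {0..1}" for t
  proof -
    have "(w_oval (Re (g t)))\<^sup>2 + (sqrt 3 * Im (g t))\<^sup>2 = 6 * H (Re (g t)) (Im (g t))"
      using w_oval_square[OF on_oval(2,3)[OF that]] by (simp add: H_def power_mult_distrib)
    then show ?thesis using on_oval(1)[OF that] by (simp add: c_def cmod_def)
  qed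
  have contc: "continuous_on {0..1} c"
    unfolding c_alt
    by (intro continuous_intros continuous_on_compose2[OF continuous_on_w_oval] contg)
       (use on_oval in auto)
  have c0: "0 \<notin> path_image c"
  proof
    assume "0 \<in> path_image c"
    then obtain t where "t \<in> {0..1}" "c t = 0" unfolding path_image_def by fastforce
    then show False using norm_c[of t] h by auto
  qed
  have pathc: "path c" using contc by (simp add: path_def)
  have loopc: "pathfinish c = pathstart c"
    using loop by (simp add: c_def pathfinish_def pathstart_def)
  have "homotopic_loops (- {0}) g c"
  proof (rule homotopic_loops_linear[OF path pathc loop loopc])
    fix t :: real assume t: "t \<in> {0..1}"
    note ov = on_oval[OF t]
    have "0 \<notin> closed_segment (g t) (c t)"
    proof
      assume "0 \<in> closed_segment (g t) (c t)"
      then obtain \<theta> where \<theta>: "0 \<le> \<theta>" "\<theta> \<le> 1" "0 = (1 - \<theta>) *\<^sub>R g t + \<theta> *\<^sub>R c t"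
        unfolding in_segment by blast
      from arg_cong[OF \<theta>(3), of Im]
      have "(1 - \<theta> + \<theta> * sqrt 3) * Im (g t) = 0" by (simp add: c_def algebra_simps)
      moreover have "1 - \<theta> + \<theta> * sqrt 3 > 0"
      proof (cases "\<theta> = 1")
        case False
        then have "1 - \<theta> > 0" using \<theta> by simp
        then show ?thesis using \<theta> by (intro add_pos_nonneg) auto
      qed simp
      ultimately have y: "Im (g t) = 0" by simp
      from arg_cong[OF \<theta>(3), of Re]
      have x: "(1 - \<theta>) * Re (g t) + \<theta> * w_oval (Re (g t)) = 0" by (simp add: c_def)
      have "Re (g t) \<noteq> 0" using ov(1) y h by (auto simp: H_def)
      then consider "Re (g t) > 0" | "Re (g t) < 0" by linarith
      then show False
      proof cases
        case 1
        then have "w_oval (Re (g t)) > 0" using w_oval_sign(1)[OF ov(2,3)] by simp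
        then show False
          using x 1 \<theta> by (smt (verit) mult_nonneg_nonneg mult_pos_pos)
      next
        case 2
        then have "w_oval (Re (g t)) < 0" using w_oval_sign(2)[OF ov(2,3)] by simp
        then show False
          using x 2 \<theta> by (smt (verit) mult_nonneg_nonpos mult_pos_neg)
      qed
    qed
    then show "closed_segment (g t) (c t) \<subseteq> - {0}" by blast
  qed
  then have wind: "winding_number c 0 = winding_number g 0"
    using winding_number_homotopic_loops by metis
  obtain q where q: "path q" "pathfinish q - pathstart q = 2 * of_real pi * \<i> * winding_number c 0"
      "\<And>t. t \<in> {0..1} \<Longrightarrow> c t = 0 + exp (q t)"
    using winding_number_as_continuous_log[OF pathc c0] by blast
  have contq: "continuous_on {0..1} q" using q(1) by (simp add: path_def)
  have polar: "w_oval (Re (g t)) = sqrt (6 * h) * cos (Im (q t))" "sqrt 3 * Im (g t) = sqrt (6 * h) * sin (Im (q t))"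
    if "t \<in> {0..1}" for t
  proof -
    have "c t = exp (q t)" using q(3)[OF that] by simp
    then have "exp (Re (q t)) = sqrt (6 * h)" using norm_c[OF that] by simp
    then have "Re (exp (q t)) = sqrt (6 * h) * cos (Im (q t))" "Im (exp (q t)) = sqrt (6 * h) * sin (Im (q t))"
      by (simp_all add: Re_exp Im_exp)
    then show "w_oval (Re (g t)) = sqrt (6 * h) * cos (Im (q t))" "sqrt 3 * Im (g t) = sqrt (6 * h) * sin (Im (q t))"
      using \<open>c t = exp (q t)\<close> by (metis c_def complex.sel)+
  qed
  show thesis
  proof
    show "continuous_on {0..1} (\<lambda>t. Im (q t))" by (intro continuous_intros contq)
    show "w_oval (Re (g t)) = sqrt (6 * h) * cos (Im (q t))" if "t \<in> {0..1}" for t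
      by (rule polar(1)[OF that])
    show "Im (g t) = sqrt (2 * h) * sin (Im (q t))" if "t \<in> {0..1}" for t
    proof -
      have "sqrt (6 * h) = sqrt 3 * sqrt (2 * h)" by (simp flip: real_sqrt_mult)
      then have "sqrt 3 * Im (g t) = sqrt 3 * (sqrt (2 * h) * sin (Im (q t)))"
        using polar(2)[OF that] by simp
      then show ?thesis by simp
    qed
    have "Im (q 1 - q 0) = Im (2 * of_real pi * \<i> * winding_number g 0)"
      using q(2) wind by (simp add: pathfinish_def pathstart_def)
    then show "Im (q 1) - Im (q 0) = 2 * pi * Re (winding_number g 0)" by simp
    fix t :: real assume t: "t \<in> {0<..<1}" and "g differentiable at t"
    then have t01: "t \<in> {0..1}" by auto
    obtain g' where g': "(g has_vector_derivative g') (at t)"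
      using \<open>g differentiable at t\<close> vector_derivative_works by blast
    obtain d where d: "(w_oval has_real_derivative d) (at (Re (g t)))"
      using w_oval_differentiable on_oval(2,3)[OF t01] by blast
    have Reg: "((\<lambda>t. Re (g t)) has_real_derivative Re g') (at t)"
         and Img: "((\<lambda>t. Im (g t)) has_real_derivative Im g') (at t)"
      using bounded_linear.has_vector_derivative[OF bounded_linear_Re g']
        bounded_linear.has_vector_derivative[OF bounded_linear_Im g']
      by (simp_all add: has_real_derivative_iff_has_vector_derivative)
    have 1: "((\<lambda>t. w_oval (Re (g t))) has_real_derivative d * Re g') (at t)"
      by (rule DERIV_chain2[OF d Reg])
    have 2: "((\<lambda>t. sqrt 3 * Im (g t)) has_real_derivative sqrt 3 * Im g') (at t)"
      by (rule DERIV_cmult[OF Img])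
    have "(c has_vector_derivative of_real (d * Re g') + \<i> * of_real (sqrt 3 * Im g')) (at t)"
      unfolding c_alt
      by (intro has_vector_derivative_add has_vector_derivative_mult_right has_vector_derivative_of_real)
         (use 1 2 in \<open>simp_all add: has_real_derivative_iff_has_vector_derivative\<close>)
    moreover have "eventually (\<lambda>s. s \<in> {0<..<1}) (nhds t)"
      using t by (intro eventually_nhds_in_open) auto
    then have ev: "eventually (\<lambda>s. s \<in> UNIV \<longrightarrow> c s = exp (q s)) (nhds t)"
      by eventually_elim (use q(3) in auto)
    ultimately have ex: "((\<lambda>s. exp (q s)) has_vector_derivative of_real (d * Re g') + \<i> * of_real (sqrt 3 * Im g')) (at t)"
      using has_vector_derivative_cong_ev[OF ev] q(3)[OF t01] by simp
    have "isCont q t"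
      using contq t by (simp add: continuous_on_interior)
    from bounded_linear.has_vector_derivative[OF bounded_linear_Im has_vector_derivative_exp_lift[OF this ex]]
    show "(\<lambda>t. Im (q t)) differentiable at t"
      by (rule differentiableI_vector)
  qed
qed

text \<open>Along the curve the form is the differential of \<open>Q \<circ> \<phi>\<close>, with \<open>Q\<close> a primitive of its angular density. The angle
  grows by \<open>2 \<pi>\<close> or \<open>- 2 \<pi>\<close>, because a simple closed curve winds once around an inside point.\<close>
lemma line_integral_oval:
  assumes h: "h \<in> {0<..<1/6}" and g: "oval_parametrization h g"
  shows "line_integral_dx (\<lambda>x y. (x + 1) powi k * y) g = - Re (winding_number g 0) * J k h"
proof -
  obtain \<phi> where \<phi>: "continuous_on {0..1} \<phi>"
    "\<And>t. t \<in> {0..1} \<Longrightarrow> w_oval (Re (g t)) = sqrt (6 * h) * cos (\<phi> t)"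
    "\<And>t. t \<in> {0..1} \<Longrightarrow> Im (g t) = sqrt (2 * h) * sin (\<phi> t)"
    "\<phi> 1 - \<phi> 0 = 2 * pi * Re (winding_number g 0)"
    "\<And>t. t \<in> {0<..<1} \<Longrightarrow> g differentiable at t \<Longrightarrow> \<phi> differentiable at t"
    by (rule oval_rectification[OF h g]) blast
  note on_oval = oval_parametrization_level(2,3)[OF g]
  define r where "r = sqrt (6 * h)"
  have r: "\<bar>r\<bar> < 1" using h by (simp add: r_def)
  define \<Psi> where "\<Psi> = (\<lambda>s. - (2 * sqrt 3 * h) * (oval_weight k (r * cos s) * (sin s)\<^sup>2))"
  have cont\<Psi>: "continuous_on S \<Psi>" for S
    unfolding \<Psi>_def by (intro continuous_intros continuous_on_oval_weight_cos r)
  obtain Q where Q: "\<And>s. (Q has_vector_derivative \<Psi> s) (at s)"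
    using einterval_antiderivative[of "-\<infinity>" "\<infinity>" \<Psi>] cont\<Psi>[of UNIV]
    by (auto simp: continuous_on_eq_continuous_at)
  have Q': "(Q has_real_derivative \<Psi> s) (at s)" for s
    using Q by (simp add: has_real_derivative_iff_has_vector_derivative)
  have "(\<Psi> has_integral (Q (2 * pi) - Q 0)) {0..2*pi}"
    by (rule fundamental_theorem_of_calculus) (simp_all add: has_vector_derivative_at_within[OF Q])
  then have "Q (2 * pi) - Q 0 = integral {0..2*pi} \<Psi>" by (simp add: integral_unique)
  also have "\<dots> = - J k h" by (simp add: \<Psi>_def J_def r_def)
  finally have Q2pi: "Q (2 * pi) - Q 0 = - J k h" .
  have period: "Q (s + 2 * pi) - Q s = - J k h" for s
  proof -
    have "((\<lambda>s. Q (s + 2 * pi) - Q s) has_real_derivative 0) (at s)" for s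
    proof -
      have "((\<lambda>s. Q (s + 2 * pi) - Q s) has_real_derivative \<Psi> (s + 2 * pi) * 1 - \<Psi> s) (at s)"
        by (intro DERIV_diff Q' DERIV_chain2[OF Q']) (auto intro!: derivative_eq_intros)
      then show ?thesis by (simp add: \<Psi>_def)
    qed
    then have "Q (s + 2 * pi) - Q s = Q (0 + 2 * pi) - Q 0"
      using DERIV_isconst_all[of "\<lambda>s. Q (s + 2 * pi) - Q s" s 0] by blast
    then show ?thesis using Q2pi by simp
  qed
  obtain S where S: "finite S" "\<And>t. t \<in> {0..1} - S \<Longrightarrow> g differentiable at t"
    using g unfolding oval_parametrization_def valid_path_def piecewise_C1_differentiable_on_def
      C1_differentiable_on_eq by blast
  have "((\<lambda>t. (Re (g t) + 1) powi k * Im (g t) * Re (vector_derivative g (at t within {0..1})))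
      has_integral ((Q \<circ> \<phi>) 1 - (Q \<circ> \<phi>) 0)) {0..1}"
  proof (rule fundamental_theorem_of_calculus_interior_strong[OF S(1)])
    fix t :: real assume t: "t \<in> {0<..<1} - S"
    then have t01: "t \<in> {0..1}" and "t \<in> {0<..<1}" by auto
    have gd: "g differentiable at t" using S(2) t by auto
    then have g': "(g has_vector_derivative vector_derivative g (at t)) (at t)"
      by (simp add: vector_derivative_works)
    then have Reg: "((\<lambda>t. Re (g t)) has_real_derivative Re (vector_derivative g (at t))) (at t)"
      using bounded_linear.has_vector_derivative[OF bounded_linear_Re g']
      by (simp add: has_real_derivative_iff_has_vector_derivative)
    have "\<phi> differentiable at t" using \<phi>(5) t gd by auto
    then obtain \<phi>' where \<phi>': "(\<phi> has_real_derivative \<phi>') (at t)"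
      using real_differentiableE by blast
    have W: "\<bar>r * cos (\<phi> t)\<bar> < 1" by (rule abs_mult_cos_less_1[OF r])
    have inner: "((\<lambda>t. r * cos (\<phi> t)) has_real_derivative r * (- sin (\<phi> t) * \<phi>')) (at t)"
      by (intro DERIV_cmult DERIV_chain2[OF DERIV_cos \<phi>'])
    have u: "((\<lambda>t. u_oval (r * cos (\<phi> t)) - 1) has_real_derivative
        u_oval' (r * cos (\<phi> t)) * (r * (- sin (\<phi> t) * \<phi>')) - 0) (at t)"
      by (intro DERIV_diff DERIV_chain2[OF u_oval_deriv[OF W] inner] DERIV_const)
    have u_eq: "u_oval (r * cos (\<phi> s)) = Re (g s) + 1" if "s \<in> {0..1}" for s
      using u_oval_w_oval[OF on_oval[OF that]] \<phi>(2)[OF that] by (simp add: r_def)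
    have "eventually (\<lambda>s. s \<in> {0<..<1}) (nhds t)"
      using t by (intro eventually_nhds_in_open) auto
    then have "eventually (\<lambda>s. u_oval (r * cos (\<phi> s)) - 1 = Re (g s)) (nhds t)"
      by eventually_elim (use u_eq in auto)
    from u[unfolded DERIV_cong_ev[OF refl this refl]]
    have Reg': "Re (vector_derivative g (at t)) = u_oval' (r * cos (\<phi> t)) * (r * (- sin (\<phi> t) * \<phi>'))"
      using DERIV_unique[OF Reg] by simp
    have rr: "sqrt (2 * h) * r = 2 * sqrt 3 * h"
    proof -
      have "r = sqrt 3 * sqrt (2 * h)" unfolding r_def by (simp flip: real_sqrt_mult)
      then have "sqrt (2 * h) * r = sqrt 3 * (sqrt (2 * h) * sqrt (2 * h))" by simp
      also have "sqrt (2 * h) * sqrt (2 * h) = 2 * h" using h by (intro real_sqrt_mult_self[THEN trans]) simp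
      finally show ?thesis by simp
    qed
    have "((Q \<circ> \<phi>) has_real_derivative \<Psi> (\<phi> t) * \<phi>') (at t)"
      using DERIV_chain[OF Q' \<phi>'] .
    moreover have "\<Psi> (\<phi> t) * \<phi>' = (Re (g t) + 1) powi k * Im (g t) * Re (vector_derivative g (at t))"
    proof -
      have "(Re (g t) + 1) powi k * Im (g t) * Re (vector_derivative g (at t))
          = - (sqrt (2 * h) * r) * (u_oval (r * cos (\<phi> t)) powi k * u_oval' (r * cos (\<phi> t)) * (sin (\<phi> t))\<^sup>2) * \<phi>'"
        unfolding Reg' \<phi>(3)[OF t01] u_eq[OF t01, symmetric] by (simp add: power2_eq_square)
      then show ?thesis unfolding rr by (simp add: \<Psi>_def oval_weight_def)
    qed
    ultimately show "((Q \<circ> \<phi>) has_vector_derivative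
        (Re (g t) + 1) powi k * Im (g t) * Re (vector_derivative g (at t within {0..1}))) (at t)"
      using t by (simp add: has_real_derivative_iff_has_vector_derivative at_within_Icc_at)
  next
    have "continuous_on UNIV Q" using Q' DERIV_isCont continuous_at_imp_continuous_on by blast
    then show "continuous_on {0..1} (Q \<circ> \<phi>)"
      by (intro continuous_on_compose \<phi>(1)) (auto intro: continuous_on_subset)
  qed simp
  then have line: "line_integral_dx (\<lambda>x y. (x + 1) powi k * y) g = Q (\<phi> 1) - Q (\<phi> 0)"
    by (simp add: line_integral_dx_def integral_unique)
  have "simple_path g" "0 \<in> inside (path_image g)" using g by (auto simp: oval_parametrization_def)
  then have "winding_number g 0 = 1 \<or> winding_number g 0 = -1"
    using simple_closed_path_winding_number_inside by metis
  then show ?thesis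
  proof
    assume n: "winding_number g 0 = 1"
    then have "\<phi> 1 = \<phi> 0 + 2 * pi" using \<phi>(4) by simp
    then show ?thesis using line period[of "\<phi> 0"] n by simp
  next
    assume n: "winding_number g 0 = -1"
    then have "\<phi> 0 = \<phi> 1 + 2 * pi" using \<phi>(4) by simp
    then show ?thesis using line period[of "\<phi> 1"] n by simp
  qed
qed

section \<open>The Chebyshev property\<close>

theorem mainTheorem5:
  fixes \<gamma> :: "real \<Rightarrow> real \<Rightarrow> complex"
  assumes oval: "\<And>h. h \<in> {0<..<1/6} \<Longrightarrow> oval_parametrization h (\<gamma> h)"
    and same_orientation:
      "\<And>h h'. h \<in> {0<..<1/6} \<Longrightarrow> h' \<in> {0<..<1/6} \<Longrightarrow>
         winding_number (\<gamma> h) 0 = winding_number (\<gamma> h') 0"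
  shows "ECT_system_set (I_tilde \<gamma>) 3 {0<..<1/6}"
proof -
  let ?L = "{0<..<1/6::real}"
  define n where "n = Re (winding_number (\<gamma> (1/12)) 0)"
  have "n \<noteq> 0"
  proof -
    have "oval_parametrization (1/12) (\<gamma> (1/12))" by (rule oval) simp
    then have "\<bar>n\<bar> = 1"
      unfolding oval_parametrization_def n_def
      by (intro simple_closed_path_abs_winding_number_inside) auto
    then show ?thesis by auto
  qed
  have I_eq: "I_tilde \<gamma> i h = - n * J (int i - 3) h" if h: "h \<in> ?L" for i h
  proof -
    have "winding_number (\<gamma> h) 0 = winding_number (\<gamma> (1/12)) 0"
      using h by (intro same_orientation) auto
    then show ?thesis
      unfolding I_tilde_def using line_integral_oval[OF h oval[OF h], of "int i - 3"] by (simp add: n_def)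
  qed
  (* The order in which the integrals form an ECT-system is Y, Z, X. *)
  define p :: "nat \<Rightarrow> nat" where "p = (\<lambda>j. if j = 0 then 1 else if j = 1 then 2 else 0)"
  have p: "bij_betw p {..<3} {..<3}"
    by (auto simp: p_def bij_betw_def inj_on_def lessThan_Suc numeral_3_eq_3)
  have I_analytic: "analytic_at_real (I_tilde \<gamma> i) h" if h: "h \<in> ?L" for i h
  proof (rule analytic_at_real_cong_open[OF open_greaterThanLessThan h])
    show "analytic_at_real (\<lambda>h. - n * J (int i - 3) h) h"
      by (intro analytic_at_real_mult analytic_at_real_const J_analytic_and_deriv(1) h)
  qed (simp only: I_eq)
  have few_zeros: "(\<exists>x\<in>?L. u x \<noteq> 0) \<and> at_most_zeros_on m u ?L"
    if "at_most_zeros_on m (\<lambda>h. a * J (-3) h + b * J (-2) h + c * J (-1) h) ?L"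
      and u: "\<And>h. h \<in> ?L \<Longrightarrow> u h = a * J (-3) h + b * J (-2) h + c * J (-1) h"
    for m u a b c
  proof -
    let ?v = "\<lambda>h. a * J (-3) h + b * J (-2) h + c * J (-1) h"
    have "at_most_zeros_on m u ?L \<longleftrightarrow> at_most_zeros_on m ?v ?L"
    proof (rule at_most_zeros_on_mult[where g = "\<lambda>_. 1"])
      show "analytic_at_real ?v h" if "h \<in> ?L" for h
        by (intro analytic_at_real_intros J_analytic_and_deriv(1) that)
    qed (auto simp: u intro: analytic_at_real_const)
    then have m: "at_most_zeros_on m u ?L" using that(1) by simp
    then have "finite {x \<in> ?L. u x = 0}" by (simp add: at_most_zeros_on_def)
    moreover have "infinite ?L" by (rule infinite_Ioo) simp
    ultimately have "{x \<in> ?L. u x = 0} \<noteq> ?L" by metis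
    then show ?thesis using m by blast
  qed
  interpret annulus_integrals "J (-3)" "J (-2)" "J (-1)" "J' 1"
    by (rule annulus_integrals_J)
  have zeros: "(\<exists>x\<in>?L. (\<Sum>j<k. \<alpha> j * I_tilde \<gamma> (p j) x) \<noteq> 0) \<and>
      at_most_zeros_on (k - 1) (\<lambda>x. \<Sum>j<k. \<alpha> j * I_tilde \<gamma> (p j) x) ?L"
    if k: "k \<in> {1..3}" and \<alpha>: "\<exists>j<k. \<alpha> j \<noteq> 0" for k and \<alpha> :: "nat \<Rightarrow> real"
  proof -
    consider "k = 1" | "k = 2" | "k = 3" using k by force
    then show ?thesis
    proof cases
      case 1
      have "\<alpha> 0 \<noteq> 0" using \<alpha> 1 by simp
      then have "at_most_zeros_on 0 (\<lambda>h. 0 * J (-3) h + (- n * \<alpha> 0) * J (-2) h + 0 * J (-1) h) ?L"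
        using \<open>n \<noteq> 0\<close> pos(2) by (intro at_most_zeros_on_0) force
      then show ?thesis
        unfolding 1 by (intro few_zeros[of "1 - 1" 0 "- n * \<alpha> 0" 0]) (simp_all add: I_eq p_def)
    next
      case 2
      have "\<alpha> 0 \<noteq> 0 \<or> \<alpha> 1 \<noteq> 0" using \<alpha> 2 by (auto simp: less_2_cases_iff)
      then have "at_most_zeros_on 1 (\<lambda>h. 0 * J (-3) h + (- n * \<alpha> 0) * J (-2) h + (- n * \<alpha> 1) * J (-1) h) ?L"
        using combination_YZ_zeros[of "- n * \<alpha> 0" "- n * \<alpha> 1"] \<open>n \<noteq> 0\<close> by auto
      then show ?thesis
        unfolding 2 by (intro few_zeros[of "2 - 1" 0 "- n * \<alpha> 0" "- n * \<alpha> 1"])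
          (simp_all add: I_eq p_def numeral_2_eq_2 algebra_simps)
    next
      case 3
      have sum3: "(\<Sum>j<3. f j) = f 0 + f 1 + f 2" for f :: "nat \<Rightarrow> real"
        by (simp add: numeral_3_eq_3 numeral_2_eq_2)
      have "\<alpha> 0 \<noteq> 0 \<or> \<alpha> 1 \<noteq> 0 \<or> \<alpha> 2 \<noteq> 0"
        using \<alpha> 3 by (auto simp: numeral_3_eq_3 less_Suc_eq numeral_2_eq_2)
      then have "at_most_zeros_on 2 (\<lambda>h. (- n * \<alpha> 2) * J (-3) h + (- n * \<alpha> 0) * J (-2) h + (- n * \<alpha> 1) * J (-1) h) ?L"
        using \<open>n \<noteq> 0\<close> by (intro combination_XYZ_zeros) auto
      then show ?thesis
        unfolding 3 sum3 by (intro few_zeros[of "3 - 1" "- n * \<alpha> 2" "- n * \<alpha> 0" "- n * \<alpha> 1"])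
          (simp_all add: I_eq p_def algebra_simps)
    qed
  qed
  have "ECT_system (\<lambda>j. I_tilde \<gamma> (p j)) 3 ?L"
    unfolding ECT_system_def
  proof (intro conjI allI ballI impI)
    show "real_analytic_on (I_tilde \<gamma> (p j)) ?L" for j
      by (rule real_analytic_on_if_analytic_at_real[OF I_analytic])
    show "is_interval ?L" by (simp add: is_interval_convex_1)
  qed (use zeros in auto)
  then show ?thesis
    unfolding ECT_system_set_def using p by blast
qed

end
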